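(* If obtuse superbases $B,B'$ generate isometric lattices $\Lambda,\Lambda'\subset\mathbb R^3$ respectively, then $\mathrm{RI}(B)=\mathrm{RI}(B')$. Hence $\mathrm{RI}$ is an isometry invariant of a lattice $\Lambda$ (independent of the choice of obtuse superbase).
   Context: A lattice $\Lambda\subset\mathbb R^3$ is the set of all integer linear combinations of a basis $v_1,v_2,v_3$ of $\mathbb R^3$. A superbase is $B=(v_0,v_1,v_2,v_3)$ with $v_1,v_2,v_3$ a basis of $\Lambda$ and $v_0=-v_1-v_2-v_3$; conorms $p_{ij}=-v_i\cdot v_j$ ($i\ne j$, $p_{ij}=p_{ji}$); $B$ is obtuse if all $p_{ij}\ge0$. Root products $r_{ij}=\sqrt{p_{ij}}$; root form $\mathrm{RF}(B)=\begin{pmatrix} r_{23}&r_{13}&r_{12}\\ r_{01}&r_{02}&r_{03}\end{pmatrix}$. Index-permutations $\sigma\in S_4$ act by $r_{ij}\mapsto r_{\sigma(i)\sigma(j)}$ (they permute columns arbitrarily and can vertically swap the entries of two columns simultaneously). The Voronoi domain $V(\Lambda)=\{p: |p|\le|p-v|\ \forall v\in\Lambda\}$ is one of: $V_1$ truncated octahedron, $V_2$ hexa-rhombic dodecahedron, $V_3$ rhombic dodecahedron, $V_4$ hexagonal prism, $V_5$ cuboid. The root invariant $\mathrm{RI}(B)$ is defined by type: ($V_5$) three root products are zero; $\mathrm{RI}(B)$ = the three non-zero ones in increasing order. ($V_4$) two zero root products in different columns; after an index-permutation $r_{23}=r_{13}=0$; $\mathrm{RI}(B)=\{(r_{12},r_{01},r_{02}),r_{03}\}$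 with the triple in increasing order. ($V_3$) two zero root products in one column (after index-permutation $r_{23}=r_{01}=0$); $\mathrm{RI}(B)$ = the four non-zero ones in increasing order. ($V_2$) exactly one zero, after index-permutation $r_{23}=0$; the entries $r_{13},r_{12},r_{03},r_{02}$, viewed as corners of a square in this cyclic order, are rearranged by a symmetry of the square so that $r_{13}$ is minimal and $r_{12}\le r_{02}$; $\mathrm{RI}(B)=\{r_{01},(r_{13},r_{12},r_{02}),r_{03}\}$. ($V_1$) all positive; by index-permutations put the overall minimum at $r_{23}$, then the minimum of columns 2,3 at $r_{13}$ (top row increasing); if $r_{23}=r_{13}$ require $r_{01}\le r_{02}$, if $r_{13}=r_{12}$ require $r_{02}\le r_{03}$; the resulting matrix is $\mathrm{RI}(B)$.
   Formalization: RI(B) is taken as the set of all results of admissible choices of index-permutation or square symmetry, since ties (e.g. in V_1 with r_13=r_02 and r_12≠r_03) leave the stated normalisation ambiguous; RI(B)=RI(B') is equality of these sets. *)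

theory Defs
  imports "HOL-Analysis.Analysis" "HOL-Combinatorics.Permutations"
begin

text \<open>A superbase of a lattice in R^3 is given by a map v :: nat => real^3 whose
  values at indices 0,1,2,3 are the vectors v_0,...,v_3 (other indices are irrelevant).\<close>

definition superbase :: "(nat \<Rightarrow> real^3) \<Rightarrow> bool" where
  "superbase v \<longleftrightarrow> independent {v 1, v 2, v 3} \<and> card {v 1, v 2, v 3} = 3
     \<and> v 0 = - (v 1 + v 2 + v 3)"

definition lattice_of :: "(nat \<Rightarrow> real^3) \<Rightarrow> (real^3) set" where
  "lattice_of v = {of_int a *\<^sub>R v 1 + of_int b *\<^sub>R v 2 + of_int c *\<^sub>R v 3 | a b c. True}"

definition conorm :: "(nat \<Rightarrow> real^3) \<Rightarrow> nat \<Rightarrow> nat \<Rightarrow> real" where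
  "conorm v i j = - (v i \<bullet> v j)"

definition obtuse :: "(nat \<Rightarrow> real^3) \<Rightarrow> bool" where
  "obtuse v \<longleftrightarrow> (\<forall>i<4. \<forall>j<4. i \<noteq> j \<longrightarrow> conorm v i j \<ge> 0)"

definition rootp :: "(nat \<Rightarrow> real^3) \<Rightarrow> nat \<Rightarrow> nat \<Rightarrow> real" where
  "rootp v i j = sqrt (conorm v i j)"

definition isometric_sets :: "(real^3) set \<Rightarrow> (real^3) set \<Rightarrow> bool" where
  "isometric_sets L L' \<longleftrightarrow> (\<exists>f. (\<forall>x y. dist (f x) (f y) = dist x y) \<and> f ` L = L')"

text \<open>Values of the root invariant, one constructor per Voronoi type.
  RI5: sorted non-zero root products (3); RI4: sorted triple and the extra entry;
  RI3: sorted non-zero root products (4); RI2: r01, triple (r13,r12,r02), r03;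
  RI1: top row and bottom row of the normalised root form.\<close>
datatype root_inv =
    RI5 "real list"
  | RI4 "real list" real
  | RI3 "real list"
  | RI2 real "real list" real
  | RI1 "real list" "real list"

definition permr :: "(nat \<Rightarrow> nat \<Rightarrow> real) \<Rightarrow> (nat \<Rightarrow> nat) \<Rightarrow> nat \<Rightarrow> nat \<Rightarrow> real" where
  "permr r \<sigma> i j = r (\<sigma> i) (\<sigma> j)"

definition zero_pairs :: "(nat \<Rightarrow> nat \<Rightarrow> real) \<Rightarrow> (nat \<times> nat) set" where
  "zero_pairs r = {(i, j). i < j \<and> j < 4 \<and> r i j = 0}"

definition rf_entries :: "(nat \<Rightarrow> nat \<Rightarrow> real) \<Rightarrow> real list" where
  "rf_entries r = [r 2 3, r 1 3, r 1 2, r 0 1, r 0 2, r 0 3]"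

text \<open>Two zeros lying in one column of the root form = two zero pairs with disjoint indices.\<close>
definition zeros_same_column :: "(nat \<Rightarrow> nat \<Rightarrow> real) \<Rightarrow> bool" where
  "zeros_same_column r \<longleftrightarrow>
     (\<forall>(i,j)\<in>zero_pairs r. \<forall>(k,l)\<in>zero_pairs r. (i,j) \<noteq> (k,l) \<longrightarrow> {i,j} \<inter> {k,l} = {})"

text \<open>Symmetries of the square with corners indexed 0,1,2,3 in cyclic order.\<close>
definition square_sym :: "(nat \<Rightarrow> nat) \<Rightarrow> bool" where
  "square_sym g \<longleftrightarrow> (\<exists>a<4. (\<forall>k. g k = (a + k) mod 4) \<or> (\<forall>k. g k = (a + 3 * k) mod 4))"

text \<open>The root invariant of a superbase, defined case by case as in the paper.
  Since the paper's normalisation is phrased as "choose a permutation/symmetry such that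
  ...", we define RI as the set of all results of admissible choices
  (a singleton when the normalisation is unambiguous).\<close>
definition RI :: "(nat \<Rightarrow> real^3) \<Rightarrow> root_inv set" where
  "RI v = (let r = rootp v; Z = zero_pairs r in
     if card Z = 3 then {RI5 (sort (filter (\<lambda>x. x \<noteq> 0) (rf_entries r)))}
     else if card Z = 2 \<and> \<not> zeros_same_column r then
       {RI4 (sort [permr r \<sigma> 1 2, permr r \<sigma> 0 1, permr r \<sigma> 0 2]) (permr r \<sigma> 0 3) | \<sigma>.
          \<sigma> permutes {..<4} \<and> permr r \<sigma> 2 3 = 0 \<and> permr r \<sigma> 1 3 = 0}
     else if card Z = 2 \<and> zeros_same_column r then
       {RI3 (sort (filter (\<lambda>x. x \<noteq> 0) (rf_entries r)))}
     else if card Z = 1 then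
       {RI2 (permr r \<sigma> 0 1) [c (g 0), c (g 1), c (g 3)] (c (g 2)) | \<sigma> g c.
          \<sigma> permutes {..<4} \<and> permr r \<sigma> 2 3 = 0 \<and> square_sym g \<and>
          c = (\<lambda>k. [permr r \<sigma> 1 3, permr r \<sigma> 1 2, permr r \<sigma> 0 3, permr r \<sigma> 0 2] ! k) \<and>
          (\<forall>k<4. c (g 0) \<le> c (g k)) \<and> c (g 1) \<le> c (g 3)}
     else if card Z = 0 then
       {RI1 [s 2 3, s 1 3, s 1 2] [s 0 1, s 0 2, s 0 3] | \<sigma> s.
          \<sigma> permutes {..<4} \<and> s = permr r \<sigma> \<and>
          (\<forall>x\<in>set (rf_entries s). s 2 3 \<le> x) \<and>
          s 1 3 \<le> s 1 2 \<and> s 1 3 \<le> s 0 2 \<and> s 1 3 \<le> s 0 3 \<and>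
          (s 2 3 = s 1 3 \<longrightarrow> s 0 1 \<le> s 0 2) \<and>
          (s 1 3 = s 1 2 \<longrightarrow> s 0 2 \<le> s 0 3)}
     else {})"

end

theory Submission
  imports Defs
begin

text \<open>An isometry of lattices may be taken linear, so it suffices to compare two obtuse superbases
  \<open>v\<close>, \<open>w\<close> of one lattice \<open>L\<close>. For a subset \<open>S\<close> of the indices, the sum of the \<open>v i\<close> over \<open>S\<close> is a
  shortest vector of its class in \<open>L/2L\<close>, so the norms of these sums, and with them the conorms,
  are determined by the classes. Consider the functional on \<open>L/2L\<close> that is 1 on every \<open>v i\<close>. If it
  is 1 on every \<open>w i\<close>, the classes of the \<open>w i\<close> are those of the \<open>v i\<close> in some order, and \<open>v\<close>, \<open>w\<close> have
  the same conorms up to an index permutation. Otherwise it is 1 on exactly two of the \<open>w i\<close>, say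
  \<open>w 2\<close> and \<open>w 3\<close>. Summing minimal norms over the odd and over the even classes then gives
  \<open>w 2 \<bullet> w 3 = 0\<close>; Selling's reduction step at this pair produces an obtuse superbase with the same
  root invariant, for which the first case applies.\<close>

section \<open>Superbases modulo twice the lattice\<close>

lemma less4_iff: "(i::nat) < 4 \<longleftrightarrow> i = 0 \<or> i = 1 \<or> i = 2 \<or> i = 3"
  by auto

lemma sum_less4: "(\<Sum>k<4. f k) = f 0 + f 1 + f 2 + f (3::nat)"
  by (simp add: eval_nat_numeral)

section \<open>Lattices as additive groups, superbases as bases of space\<close>

lemma lattice_of_diff:
  assumes "x \<in> lattice_of v" "y \<in> lattice_of v"
  shows "x - y \<in> lattice_of v"
proof -
  obtain a b c where x: "x = of_int a *\<^sub>R v 1 + of_int b *\<^sub>R v 2 + of_int c *\<^sub>R v 3"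
    using assms unfolding lattice_of_def by blast
  obtain a' b' c' where y: "y = of_int a' *\<^sub>R v 1 + of_int b' *\<^sub>R v 2 + of_int c' *\<^sub>R v 3"
    using assms unfolding lattice_of_def by blast
  have "x - y = of_int (a - a') *\<^sub>R v 1 + of_int (b - b') *\<^sub>R v 2 + of_int (c - c') *\<^sub>R v 3"
    unfolding x y by (simp add: algebra_simps)
  then show ?thesis unfolding lattice_of_def by blast
qed

lemma lattice_of_0: "0 \<in> lattice_of v"
  unfolding lattice_of_def by (auto intro!: exI[of _ 0])

lemma lattice_of_minus: "x \<in> lattice_of v \<Longrightarrow> - x \<in> lattice_of v"
  using lattice_of_diff[OF lattice_of_0, of x v] by simp

lemma lattice_of_add: "x \<in> lattice_of v \<Longrightarrow> y \<in> lattice_of v \<Longrightarrow> x + y \<in> lattice_of v"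
  using lattice_of_diff[of x v "- y"] lattice_of_minus[of y v] by simp

lemma lattice_of_scale:
  assumes "x \<in> lattice_of v"
  shows "of_int n *\<^sub>R x \<in> lattice_of v"
proof -
  obtain a b c where x: "x = of_int a *\<^sub>R v 1 + of_int b *\<^sub>R v 2 + of_int c *\<^sub>R v 3"
    using assms unfolding lattice_of_def by blast
  have "of_int n *\<^sub>R x = of_int (n*a) *\<^sub>R v 1 + of_int (n*b) *\<^sub>R v 2 + of_int (n*c) *\<^sub>R v 3"
    unfolding x by (simp add: algebra_simps)
  then show ?thesis unfolding lattice_of_def by blast
qed

lemma lattice_of_subset:
  assumes "w 1 \<in> lattice_of v" "w 2 \<in> lattice_of v" "w 3 \<in> lattice_of v"
  shows "lattice_of w \<subseteq> lattice_of v"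
proof
  fix x assume "x \<in> lattice_of w"
  then obtain a b c where "x = of_int a *\<^sub>R w 1 + of_int b *\<^sub>R w 2 + of_int c *\<^sub>R w 3"
    unfolding lattice_of_def by blast
  then show "x \<in> lattice_of v"
    using assms by (simp add: lattice_of_add lattice_of_scale)
qed

lemma superbase_zero: "superbase v \<Longrightarrow> v 0 = - (v 1 + v 2 + v 3)"
  by (simp add: superbase_def)

lemma superbase_mem_lattice:
  assumes "v 0 = - (v 1 + v 2 + v 3)" "k < 4"
  shows "v k \<in> lattice_of v"
proof -
  have 1: "v 1 \<in> lattice_of v"
    unfolding lattice_of_def mem_Collect_eq by (intro exI[of _ 1] exI[of _ 0]) simp
  have 2: "v 2 \<in> lattice_of v"
    unfolding lattice_of_def mem_Collect_eq by (rule exI[of _ 0], rule exI[of _ 1], rule exI[of _ 0]) simp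
  have 3: "v 3 \<in> lattice_of v"
    unfolding lattice_of_def mem_Collect_eq by (rule exI[of _ 0], rule exI[of _ 0], rule exI[of _ 1]) simp
  have "v 0 \<in> lattice_of v"
    using assms(1) 1 2 3 by (metis lattice_of_add lattice_of_minus)
  then show ?thesis using 1 2 3 assms(2) unfolding less4_iff by auto
qed

lemma superbase_indep:
  assumes "superbase v" "a *\<^sub>R v 1 + b *\<^sub>R v 2 + c *\<^sub>R v 3 = 0"
  shows "a = 0 \<and> b = 0 \<and> c = 0"
proof -
  have ind: "independent {v 1, v 2, v 3}" and "card {v 1, v 2, v 3} = 3"
    using assms by (auto simp: superbase_def)
  then have d: "v 1 \<noteq> v 2" "v 1 \<noteq> v 3" "v 2 \<noteq> v 3"
    by (auto simp: card_insert_if split: if_splits)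
  define u where "u x = (if x = v 1 then a else if x = v 2 then b else c)" for x
  have "(\<Sum>x\<in>{v 1, v 2, v 3}. u x *\<^sub>R x) = 0"
    using d assms(2) by (simp add: u_def algebra_simps)
  from independentD[OF ind _ subset_refl this]
  have "u (v 1) = 0" "u (v 2) = 0" "u (v 3) = 0" by auto
  then show ?thesis using d by (auto simp: u_def)
qed

lemma superbase_span: "superbase v \<Longrightarrow> span {v 1, v 2, v 3} = UNIV"
proof -
  assume "superbase v"
  then have "independent {v 1, v 2, v 3}" "card {v 1, v 2, v 3} = 3"
    by (auto simp: superbase_def)
  then have "dim {v 1, v 2, v 3} = DIM(real^3)" by (simp add: dim_eq_card_independent)
  then show ?thesis by (simp only: dim_eq_full)
qed

text \<open>The span of \<open>u 1\<close>, \<open>u 2\<close>, \<open>u 3\<close> contains the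
  basis belonging to \<open>v\<close>, hence is all of space; three vectors spanning a 3-dimensional
  space are distinct and independent. Index permutations, Selling's step and linear isometries all
  produce superbases through this criterion.\<close>

lemma superbase_of_lattice:
  assumes v: "superbase v" and u: "u 0 = - (u 1 + u 2 + u 3)" "lattice_of u = lattice_of v"
  shows "superbase u"
proof -
  define B where "B = {u 1, u 2, u 3}"
  have "lattice_of u \<subseteq> span B"
    unfolding lattice_of_def by (clarify, intro span_add span_scale span_base) (simp_all add: B_def)
  moreover have "{v 1, v 2, v 3} \<subseteq> lattice_of v"
    using superbase_mem_lattice[OF superbase_zero[OF v]] by simp
  ultimately have "{v 1, v 2, v 3} \<subseteq> span B"
    using u(2) by blast
  then have "span {v 1, v 2, v 3} \<subseteq> span B"
    by (rule span_minimal) (rule subspace_span)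
  then have sp: "span B = UNIV"
    using superbase_span[OF v] by blast
  have "dim B = DIM(real^3)" using sp by (simp only: dim_eq_full)
  then have "dim B = 3" by simp
  moreover have "finite B" by (simp add: B_def)
  moreover have "card B \<le> 3" by (simp add: B_def card_insert_if)
  ultimately have c: "card B = 3" using dim_le_card'[of B] by linarith
  have "independent B"
  proof (rule card_le_dim_spanning)
    show "UNIV \<subseteq> span B" using sp by (rule equalityD2)
    show "card B \<le> dim (UNIV :: (real^3) set)" using c by simp
  qed (use \<open>finite B\<close> in simp_all)
  then show ?thesis unfolding superbase_def using c u(1) unfolding B_def by blast
qed

text \<open>On the lattice \<open>g\<close> is the sum of the three coordinates, an integer; its
  parity is the functional on \<open>L/2L\<close> that separates odd from even classes. On
  \<open>v 0\<close> its value is -3, again odd.\<close>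

lemma superbase_functional:
  assumes "superbase v"
  obtains g :: "real^3 \<Rightarrow> real" where "linear g" "g (v 1) = 1" "g (v 2) = 1" "g (v 3) = 1"
proof -
  have "independent {v 1, v 2, v 3}" using assms by (simp add: superbase_def)
  from linear_independent_extend[OF this, of "\<lambda>_. 1::real"] show ?thesis using that by auto
qed

text \<open>Selling's formula. The four vectors sum to 0, so adding a constant to all coefficients
  changes nothing and only differences of coefficients occur. For an obtuse superbase all weights
  are non-negative.\<close>

lemma norm_superbase_combination:
  assumes "superbase v"
  shows "(norm (\<Sum>k<4. y k *\<^sub>R v k))\<^sup>2 =
    conorm v 0 1 * (y 0 - y 1)\<^sup>2 + conorm v 0 2 * (y 0 - y 2)\<^sup>2 + conorm v 0 3 * (y 0 - y 3)\<^sup>2 +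
    conorm v 1 2 * (y 1 - y 2)\<^sup>2 + conorm v 1 3 * (y 1 - y 3)\<^sup>2 + conorm v 2 3 * (y 2 - y 3)\<^sup>2"
proof -
  define a b c where abc: "a = v 1" "b = v 2" "c = v 3"
  have v0: "v 0 = - (a + b + c)" using superbase_zero[OF assms] abc by simp
  have comm: "b \<bullet> a = a \<bullet> b" "c \<bullet> a = a \<bullet> c" "c \<bullet> b = b \<bullet> c" by (rule inner_commute)+
  have "(\<Sum>k<4. y k *\<^sub>R v k) = (y 1 - y 0) *\<^sub>R a + (y 2 - y 0) *\<^sub>R b + (y 3 - y 0) *\<^sub>R c"
    unfolding sum_less4 v0 abc[symmetric] by (simp add: algebra_simps)
  then show ?thesis
    unfolding power2_norm_eq_inner \<open>(\<Sum>k<4. y k *\<^sub>R v k) = _\<close> conorm_def v0 abc[symmetric]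
    by (simp add: inner_add_left inner_add_right comm power2_eq_square algebra_simps)
qed

text \<open>Modulo \<open>2L\<close> the parities of the coordinate differences are fixed, so each square in the sum of
  squares above is at least its value (0 or 1) at the cut vector.\<close>

lemma cut_vector_minimal:
  assumes "superbase v" "obtuse v" "S \<subseteq> {..<4}" "t \<in> lattice_of v"
  shows "norm (sum v S) \<le> norm (sum v S + 2 *\<^sub>R t)"
proof -
  obtain a b c where t: "t = of_int a *\<^sub>R v 1 + of_int b *\<^sub>R v 2 + of_int c *\<^sub>R v 3"
    using assms(4) unfolding lattice_of_def by blast
  define x :: "nat \<Rightarrow> int" where "x k = (if k \<in> S then 1 else 0)" for k
  \<comment> \<open>The coefficient of \<open>v 0\<close> may be taken to be 0, since
    \<open>t\<close> is an integer combination of \<open>v 1\<close>, \<open>v 2\<close>,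
    \<open>v 3\<close>.\<close>
  define z where "z = (\<lambda>k. [0, a, b, c] ! k)"
  define y where "y k = x k + 2 * z k" for k
  have sx: "sum v S = (\<Sum>k<4. of_int (x k) *\<^sub>R v k)"
  proof -
    have "(\<Sum>k<4. of_int (x k) *\<^sub>R v k) = (\<Sum>k<4. if k \<in> S then v k else 0)"
      by (intro sum.cong) (auto simp: x_def)
    also have "\<dots> = sum v ({..<4} \<inter> S)" by (simp add: sum.inter_restrict)
    also have "{..<4} \<inter> S = S" using assms(3) by blast
    finally show ?thesis by simp
  qed
  have sy: "sum v S + 2 *\<^sub>R t = (\<Sum>k<4. of_int (y k) *\<^sub>R v k)"
    unfolding sx t sum_less4 y_def z_def by (simp add: algebra_simps)
  have le: "(of_int (x i) - of_int (x j) :: real)\<^sup>2 \<le> (of_int (y i) - of_int (y j))\<^sup>2" for i j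
  proof -
    have "\<bar>x i - x j\<bar> \<le> \<bar>y i - y j\<bar>"
    proof -
      have "\<bar>a\<bar> \<le> \<bar>a + 2 * b\<bar>" if "a \<in> {-1, 0, 1}" for a b :: int
        using that by (elim insertE emptyE; hypsubst; arith)
      from this[of "x i - x j" "z i - z j"] show ?thesis
        by (simp add: y_def x_def algebra_simps)
    qed
    then have "(x i - x j)\<^sup>2 \<le> (y i - y j)\<^sup>2" by (simp add: abs_le_square_iff)
    then have "of_int ((x i - x j)\<^sup>2) \<le> (of_int ((y i - y j)\<^sup>2) :: real)"
      by (simp only: of_int_le_iff)
    then show ?thesis by simp
  qed
  have p: "conorm v i j \<ge> 0" if "i < 4" "j < 4" "i \<noteq> j" for i j
    using assms(2) that by (auto simp: obtuse_def)
  have "(norm (sum v S))\<^sup>2 \<le> (norm (sum v S + 2 *\<^sub>R t))\<^sup>2"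
    unfolding sy unfolding sx norm_superbase_combination[OF assms(1)]
    by (intro add_mono mult_left_mono le p) auto
  then show ?thesis by (simp add: power2_le_iff_abs_le)
qed

text \<open>Both sums lie in the same class modulo \<open>2L\<close>, and each is shortest in its
  class. This is the only way in which metric data pass from one superbase to the other.\<close>

lemma cut_vector_norm_eq:
  assumes "superbase v" "obtuse v" "superbase w" "obtuse w" "lattice_of w = lattice_of v"
    and "S \<subseteq> {..<4}" "T \<subseteq> {..<4}" "t \<in> lattice_of v" "sum w T = sum v S + 2 *\<^sub>R t"
  shows "norm (sum w T) = norm (sum v S)"
proof (rule antisym)
  have "sum v S = sum w T + 2 *\<^sub>R (- t)" using assms(9) by simp
  then show "norm (sum w T) \<le> norm (sum v S)"
    using cut_vector_minimal[of w T "- t"] assms by (simp add: lattice_of_minus)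
  show "norm (sum v S) \<le> norm (sum w T)"
    using cut_vector_minimal[of v S t] assms by simp
qed

text \<open>An odd coordinate sum means that one coordinate is odd, giving the class of
  \<open>v 1\<close>, \<open>v 2\<close> or \<open>v 3\<close>, or that all three are, giving the
  class of \<open>v 0\<close>.\<close>

lemma odd_class_superbase:
  assumes v: "superbase v" and x: "x \<in> lattice_of v"
    and g: "linear g" "g (v 1) = 1" "g (v 2) = 1" "g (v 3) = (1::real)"
    and odd: "g x = of_int n" "odd n"
  shows "\<exists>i<4. \<exists>t\<in>lattice_of v. x = v i + 2 *\<^sub>R t"
proof -
  obtain a b c where xx: "x = of_int a *\<^sub>R v 1 + of_int b *\<^sub>R v 2 + of_int c *\<^sub>R v 3"
    using x unfolding lattice_of_def by blast
  have "g x = of_int (a + b + c)" unfolding xx using g by (simp add: linear_add linear_scale)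
  then have "a + b + c = n" using odd(1) by (metis of_int_eq_iff)
  then have o: "odd (a + b + c)" using odd(2) by simp
  have w: "\<exists>i<4. \<exists>t\<in>lattice_of v. x = v i + 2 *\<^sub>R t"
    if "i < 4" "x = v i + 2 *\<^sub>R (of_int a' *\<^sub>R v 1 + of_int b' *\<^sub>R v 2 + of_int c' *\<^sub>R v 3)" for i a' b' c'
    using that unfolding lattice_of_def by blast
  consider "odd a" "even b" "even c" | "even a" "odd b" "even c" | "even a" "even b" "odd c"
    | "odd a" "odd b" "odd c" using o by auto
  then show ?thesis
  proof cases
    case 1
    then obtain a' b' c' where "a = 2*a'+1" "b = 2*b'" "c = 2*c'" by (auto elim!: oddE evenE)
    then show ?thesis by (intro w[of 1 a' b' c']) (auto simp: xx algebra_simps)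
  next
    case 2
    then obtain a' b' c' where "a = 2*a'" "b = 2*b'+1" "c = 2*c'" by (auto elim!: oddE evenE)
    then show ?thesis by (intro w[of 2 a' b' c']) (auto simp: xx algebra_simps)
  next
    case 3
    then obtain a' b' c' where "a = 2*a'" "b = 2*b'" "c = 2*c'+1" by (auto elim!: oddE evenE)
    then show ?thesis by (intro w[of 3 a' b' c']) (auto simp: xx algebra_simps)
  next
    case 4
    then obtain a' b' c' where "a = 2*a'+1" "b = 2*b'+1" "c = 2*c'+1" by (auto elim!: oddE)
    \<comment> \<open>The shift by 1 compensates the coefficients -1 of \<open>v 0\<close>:
      \<open>2*a'+1 = -1 + 2*(a'+1)\<close>.\<close>
    then show ?thesis
      by (intro w[of 0 "a'+1" "b'+1" "c'+1"]) (auto simp: xx superbase_zero[OF v] vec_eq_iff algebra_simps)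
  qed
qed

text \<open>Modulo 2 the coordinate vectors of the \<open>w k\<close> are the three unit vectors and
  (1,1,1), which are pairwise different.\<close>

lemma superbase_incongruent:
  assumes w: "superbase w" and "i < 4" "j < 4" "i \<noteq> j" "t \<in> lattice_of w"
  shows "w i \<noteq> w j + 2 *\<^sub>R t"
proof
  assume e: "w i = w j + 2 *\<^sub>R t"
  obtain a b c where t: "t = of_int a *\<^sub>R w 1 + of_int b *\<^sub>R w 2 + of_int c *\<^sub>R w 3"
    using assms(5) unfolding lattice_of_def by blast
  \<comment> \<open>For \<open>l\<close> from 1 to 3, \<open>d k l\<close> is the coordinate of
    \<open>w k\<close> along \<open>w l\<close>.\<close>
  define d :: "nat \<Rightarrow> nat \<Rightarrow> int" where "d k l = (if k = l then 1 else if k = 0 then -1 else 0)" for k l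
  have d: "w k = of_int (d k 1) *\<^sub>R w 1 + of_int (d k 2) *\<^sub>R w 2 + of_int (d k 3) *\<^sub>R w 3"
    if "k < 4" for k
    using that superbase_zero[OF w] unfolding less4_iff d_def by auto
  have "of_int (d i 1 - d j 1 - 2*a) *\<^sub>R w 1 + of_int (d i 2 - d j 2 - 2*b) *\<^sub>R w 2
      + of_int (d i 3 - d j 3 - 2*c) *\<^sub>R w 3 = w i - w j - 2 *\<^sub>R t"
    unfolding t d[OF assms(2)] d[OF assms(3)] by (simp add: algebra_simps)
  also have "\<dots> = 0" using e by simp
  finally have "d i 1 - d j 1 = 2*a \<and> d i 2 - d j 2 = 2*b \<and> d i 3 - d j 3 = 2*c"
    using superbase_indep[OF w] by (metis of_int_eq_0_iff eq_iff_diff_eq_0)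
  then have "even (d i 1 - d j 1)" "even (d i 2 - d j 2)" "even (d i 3 - d j 3)" by auto
  then show False using assms(2-4) unfolding less4_iff d_def by (elim disjE) simp_all
qed

text \<open>Every \<open>w k\<close> falls into the class of some \<open>v i\<close>, and different
  \<open>w k\<close> fall into different classes; an injection of a four-element set into itself is
  a bijection.\<close>

lemma odd_superbase_permutation:
  assumes v: "superbase v" and w: "superbase w" and L: "lattice_of w = lattice_of v"
    and g: "linear g" "g (v 1) = 1" "g (v 2) = 1" "g (v 3) = (1::real)"
    and odd: "\<And>k. k < 4 \<Longrightarrow> \<exists>n. g (w k) = of_int n \<and> odd n"
  obtains \<tau> where "\<tau> permutes {..<4}" "\<And>k. k < 4 \<Longrightarrow> \<exists>t\<in>lattice_of v. w k = v (\<tau> k) + 2 *\<^sub>R t"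
proof -
  have "\<exists>i. i < 4 \<and> (\<exists>t\<in>lattice_of v. w k = v i + 2 *\<^sub>R t)" if "k < 4" for k
    using odd_class_superbase[OF v _ g, of "w k"] odd[OF that] superbase_mem_lattice[OF superbase_zero[OF w] that] L by blast
  then obtain s where s: "\<And>k. k < 4 \<Longrightarrow> s k < 4 \<and> (\<exists>t\<in>lattice_of v. w k = v (s k) + 2 *\<^sub>R t)"
    by metis
  \<comment> \<open>The relation \<open>permutes\<close> demands that indices outside the set stay
    fixed.\<close>
  define \<tau> where "\<tau> k = (if k < 4 then s k else k)" for k
  have inj: "inj_on \<tau> {..<4}"
  proof (rule inj_onI, rule ccontr)
    fix i j assume ij: "i \<in> {..<4}" "j \<in> {..<4}" "\<tau> i = \<tau> j" "i \<noteq> j"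
    obtain t t' where "t \<in> lattice_of v" "w i = v (\<tau> i) + 2 *\<^sub>R t"
      "t' \<in> lattice_of v" "w j = v (\<tau> j) + 2 *\<^sub>R t'"
      using s ij by (metis \<tau>_def lessThan_iff)
    then have "w i = w j + 2 *\<^sub>R (t - t')" "t - t' \<in> lattice_of w"
      using ij L by (auto simp: algebra_simps lattice_of_diff)
    then show False using superbase_incongruent[OF w, of i j] ij by blast
  qed
  have "\<tau> ` {..<4} \<subseteq> {..<4}" using s by (auto simp: \<tau>_def)
  then have "bij_betw \<tau> {..<4} {..<4}"
    using inj by (simp add: bij_betw_def endo_inj_surj)
  then have "\<tau> permutes {..<4}" by (intro bij_imp_permutes) (auto simp: \<tau>_def)
  then show ?thesis using that s by (simp add: \<tau>_def)
qed

text \<open>Polarization: conorms are determined by the norms of sums over index sets of size one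
  and two, to which minimality in classes applies.\<close>

lemma conorm_polar: "conorm v i j = ((norm (v i))\<^sup>2 + (norm (v j))\<^sup>2 - (norm (v i + v j))\<^sup>2) / 2"
  unfolding power2_norm_eq_inner conorm_def by (simp add: inner_simps inner_commute)

lemma conorm_commute: "conorm v i j = conorm v j i"
  by (simp add: conorm_def inner_commute)

lemma conorm_congruent_superbase:
  assumes "superbase v" "obtuse v" "superbase w" "obtuse w" and L: "lattice_of w = lattice_of v"
    and \<tau>: "\<tau> permutes {..<4}" "\<And>k. k < 4 \<Longrightarrow> \<exists>t\<in>lattice_of v. w k = v (\<tau> k) + 2 *\<^sub>R t"
    and ij: "i < 4" "j < 4" "i \<noteq> j"
  shows "conorm w i j = conorm v (\<tau> i) (\<tau> j)"
proof -
  have \<tau>l: "\<tau> k < 4" if "k < 4" for k using permutes_in_image[OF \<tau>(1), of k] that by simp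
  have ne: "\<tau> i \<noteq> \<tau> j" using \<tau>(1) ij by (metis permutes_inj injD)
  have 1: "norm (w k) = norm (v (\<tau> k))" if k: "k < 4" for k
  proof -
    obtain t where "t \<in> lattice_of v" "w k = v (\<tau> k) + 2 *\<^sub>R t" using \<tau>(2)[OF k] by blast
    then show ?thesis using cut_vector_norm_eq[OF assms(1-5), of "{\<tau> k}" "{k}" t] \<tau>l k by simp
  qed
  obtain t where t: "t \<in> lattice_of v" "w i = v (\<tau> i) + 2 *\<^sub>R t" using \<tau>(2) ij by blast
  obtain t' where t': "t' \<in> lattice_of v" "w j = v (\<tau> j) + 2 *\<^sub>R t'" using \<tau>(2) ij by blast
  have "norm (w i + w j) = norm (v (\<tau> i) + v (\<tau> j))"
    using cut_vector_norm_eq[OF assms(1-5), of "{\<tau> i, \<tau> j}" "{i, j}" "t + t'"] \<tau>l ij ne t t'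
    by (simp add: lattice_of_add algebra_simps)
  then show ?thesis unfolding conorm_polar using 1 ij by simp
qed

section \<open>Symmetries of the root invariant\<close>

text \<open>The common shape of the cases V1, V2 and V4: choose an index permutation, then
  normalise. \<open>N\<close> is a relation because normalising may involve a further choice.
  Invariance under relabelling is then proved once for all three.\<close>

definition normal_forms :: "((nat \<Rightarrow> nat \<Rightarrow> real) \<Rightarrow> root_inv \<Rightarrow> bool) \<Rightarrow> (nat \<Rightarrow> nat \<Rightarrow> real) \<Rightarrow> root_inv set"
  where "normal_forms N r = {y. \<exists>\<sigma>. \<sigma> permutes {..<4} \<and> N (permr r \<sigma>) y}"

definition normal4 :: "(nat \<Rightarrow> nat \<Rightarrow> real) \<Rightarrow> root_inv \<Rightarrow> bool" where
  "normal4 s y \<longleftrightarrow> s 2 3 = 0 \<and> s 1 3 = 0 \<and> y = RI4 (sort [s 1 2, s 0 1, s 0 2]) (s 0 3)"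

text \<open>In this cyclic order opposite corners are the entries sharing index 3 (positions 0 and
  2) or index 2 (positions 1 and 3).\<close>

definition square_corners :: "(nat \<Rightarrow> nat \<Rightarrow> real) \<Rightarrow> nat \<Rightarrow> real" where
  "square_corners s = (\<lambda>k. [s 1 3, s 1 2, s 0 3, s 0 2] ! k)"

definition normal2 :: "(nat \<Rightarrow> nat \<Rightarrow> real) \<Rightarrow> root_inv \<Rightarrow> bool" where
  "normal2 s y \<longleftrightarrow> s 2 3 = 0 \<and> (\<exists>g. square_sym g \<and>
     (\<forall>k<4. square_corners s (g 0) \<le> square_corners s (g k)) \<and>
     square_corners s (g 1) \<le> square_corners s (g 3) \<and>
     y = RI2 (s 0 1) (map (square_corners s \<circ> g) [0, 1, 3]) (square_corners s (g 2)))"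

definition normal1 :: "(nat \<Rightarrow> nat \<Rightarrow> real) \<Rightarrow> root_inv \<Rightarrow> bool" where
  "normal1 s y \<longleftrightarrow> (\<forall>x\<in>set (rf_entries s). s 2 3 \<le> x) \<and>
     s 1 3 \<le> s 1 2 \<and> s 1 3 \<le> s 0 2 \<and> s 1 3 \<le> s 0 3 \<and>
     (s 2 3 = s 1 3 \<longrightarrow> s 0 1 \<le> s 0 2) \<and> (s 1 3 = s 1 2 \<longrightarrow> s 0 2 \<le> s 0 3) \<and>
     y = RI1 [s 2 3, s 1 3, s 1 2] [s 0 1, s 0 2, s 0 3]"

text \<open>The body of \<^const>\<open>RI\<close>, as a function of an arbitrary symmetric matrix of root products.\<close>

definition root_inv_of :: "(nat \<Rightarrow> nat \<Rightarrow> real) \<Rightarrow> root_inv set" where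
  "root_inv_of r = (let n = card (zero_pairs r); es = sort (filter (\<lambda>x. x \<noteq> 0) (rf_entries r)) in
     if n = 3 then {RI5 es}
     else if n = 2 \<and> \<not> zeros_same_column r then normal_forms normal4 r
     else if n = 2 then {RI3 es}
     else if n = 1 then normal_forms normal2 r
     else if n = 0 then normal_forms normal1 r
     else {})"

lemma RI_eq_root_inv_of: "RI v = root_inv_of (rootp v)"
proof -
  define r where "r = rootp v"
  have "{RI4 (sort [permr r \<sigma> 1 2, permr r \<sigma> 0 1, permr r \<sigma> 0 2]) (permr r \<sigma> 0 3) | \<sigma>.
          \<sigma> permutes {..<4} \<and> permr r \<sigma> 2 3 = 0 \<and> permr r \<sigma> 1 3 = 0} = normal_forms normal4 r"
    unfolding normal_forms_def normal4_def by blast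
  moreover have "{RI2 (permr r \<sigma> 0 1) [c (g 0), c (g 1), c (g 3)] (c (g 2)) | \<sigma> g c.
          \<sigma> permutes {..<4} \<and> permr r \<sigma> 2 3 = 0 \<and> square_sym g \<and>
          c = (\<lambda>k. [permr r \<sigma> 1 3, permr r \<sigma> 1 2, permr r \<sigma> 0 3, permr r \<sigma> 0 2] ! k) \<and>
          (\<forall>k<4. c (g 0) \<le> c (g k)) \<and> c (g 1) \<le> c (g 3)} = normal_forms normal2 r"
    unfolding normal_forms_def normal2_def square_corners_def[symmetric] list.map comp_def by blast
  moreover have "{RI1 [s 2 3, s 1 3, s 1 2] [s 0 1, s 0 2, s 0 3] | \<sigma> s.
          \<sigma> permutes {..<4} \<and> s = permr r \<sigma> \<and>
          (\<forall>x\<in>set (rf_entries s). s 2 3 \<le> x) \<and>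
          s 1 3 \<le> s 1 2 \<and> s 1 3 \<le> s 0 2 \<and> s 1 3 \<le> s 0 3 \<and>
          (s 2 3 = s 1 3 \<longrightarrow> s 0 1 \<le> s 0 2) \<and>
          (s 1 3 = s 1 2 \<longrightarrow> s 0 2 \<le> s 0 3)} = normal_forms normal1 r"
    unfolding normal_forms_def normal1_def by blast
  ultimately show ?thesis
    unfolding RI_def root_inv_of_def Let_def r_def[symmetric] by simp
qed

section \<open>Invariance under index permutations\<close>

lemma card_zero_pairs: "card (zero_pairs r) = length (filter (\<lambda>x. x = 0) (rf_entries r))"
proof -
  define ps :: "(nat \<times> nat) list" where "ps = [(2,3), (1,3), (1,2), (0,1), (0,2), (0,3)]"
  have ps: "(i, j) \<in> set ps \<longleftrightarrow> i < j \<and> j < 4" for i j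
    unfolding ps_def less4_iff by auto
  have "zero_pairs r = set (filter (\<lambda>p. r (fst p) (snd p) = 0) ps)"
    unfolding zero_pairs_def using ps by auto
  moreover have "distinct (filter (\<lambda>p. r (fst p) (snd p) = 0) ps)"
    by (rule distinct_filter) (simp add: ps_def)
  ultimately have "card (zero_pairs r) = length (filter (\<lambda>p. r (fst p) (snd p) = 0) ps)"
    by (simp only: distinct_card)
  also have "\<dots> = length (filter (\<lambda>x. x = 0) (map (\<lambda>p. r (fst p) (snd p)) ps))"
    by (simp only: filter_map length_map comp_def)
  finally show ?thesis by (simp only: ps_def rf_entries_def list.map fst_conv snd_conv)
qed

text \<open>Two different index pairs are disjoint or share exactly one index, so the condition
  fails precisely when two zeros meet at an index \<open>i\<close>. In this form no ordering of the
  indices is involved, and it is transported directly by permutations.\<close>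

lemma zeros_same_column_iff:
  assumes "\<And>i j. r i j = r j i"
  shows "zeros_same_column r \<longleftrightarrow>
    (\<forall>i<4. \<forall>j<4. \<forall>k<4. i \<noteq> j \<longrightarrow> i \<noteq> k \<longrightarrow> j \<noteq> k \<longrightarrow> r i j = 0 \<longrightarrow> r i k \<noteq> 0)"
  (is "_ \<longleftrightarrow> ?R")
proof
  assume z: "zeros_same_column r"
  show ?R
  proof (intro allI impI notI)
    fix i j k :: nat assume h: "i < 4" "j < 4" "k < 4" "i \<noteq> j" "i \<noteq> k" "j \<noteq> k" "r i j = 0" "r i k = 0"
    have m: "(min a b, max a b) \<in> zero_pairs r" if "a < 4" "b < 4" "a \<noteq> b" "r a b = 0" for a b
      using that assms[of a b] by (auto simp: zero_pairs_def min_def max_def)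
    have "(min i j, max i j) \<noteq> (min i k, max i k)" using h by (auto simp: min_def max_def split: if_splits)
    with z m[of i j] m[of i k] h have "{min i j, max i j} \<inter> {min i k, max i k} = {}"
      unfolding zeros_same_column_def by fast
    then show False by (auto simp: min_def max_def split: if_splits)
  qed
next
  assume R: ?R
  then have R': "r i k \<noteq> 0" if "i < 4" "j < 4" "k < 4" "i \<noteq> j" "i \<noteq> k" "j \<noteq> k" "r i j = 0" for i j k
    using that by blast
  have "{i, j} \<inter> {k, l} = {}"
    if h: "i < j" "j < 4" "r i j = 0" "k < l" "l < 4" "r k l = 0" "(i, j) \<noteq> (k, l)" for i j k l
  proof (rule ccontr)
    assume "{i, j} \<inter> {k, l} \<noteq> {}"
    then consider "i = k" | "i = l" | "j = k" | "j = l" by blast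
    then show False
    proof cases
      case 1 then show False using R'[of i j l] h by auto
    next
      case 2 then show False using R'[of i j k] h assms[of k l] by auto
    next
      case 3 then show False using R'[of j i l] h assms[of i j] by auto
    next
      case 4 then show False using R'[of j i k] h assms[of i j] assms[of k l] by auto
    qed
  qed
  then show "zeros_same_column r" unfolding zeros_same_column_def zero_pairs_def by blast
qed

lemma mset_rf_entries_transpose:
  assumes "\<And>i j. r i j = r j i" "a < 4" "b < 4"
  shows "mset (rf_entries (permr r (Transposition.transpose a b))) = mset (rf_entries r)"
proof -
  have "r 1 0 = r 0 1" "r 2 0 = r 0 2" "r 3 0 = r 0 3" "r 2 1 = r 1 2" "r 3 1 = r 1 3" "r 3 2 = r 2 3"
    by (rule assms(1))+
  then show ?thesis
    using assms(2,3) unfolding less4_iff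
    by (elim disjE) (simp_all add: rf_entries_def permr_def Transposition.transpose_def add_mset_commute)
qed

text \<open>Transpositions generate all permutations, and for one transposition the claim is a
  finite check. The matrix is generalised in the induction because splitting off a transposition
  replaces \<open>r\<close> by its relabelling.\<close>

lemma mset_rf_entries_relabel:
  assumes sym: "\<And>i j. r i j = r j i"
    and \<tau>: "\<tau> permutes {..<4}"
  shows "mset (rf_entries (permr r \<tau>)) = mset (rf_entries r)"
  using \<tau> finite_lessThan[of "4::nat"] sym
proof (induction \<tau> arbitrary: r rule: permutes_induct)
  case id
  then show ?case by (simp add: permr_def[abs_def])
next
  case (swap a b p)
  have e: "permr r (Transposition.transpose a b \<circ> p) = permr (permr r (Transposition.transpose a b)) p"
    by (simp add: permr_def[abs_def])
  have "permr r (Transposition.transpose a b) i j = permr r (Transposition.transpose a b) j i" for i j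
    unfolding permr_def by (rule swap.prems)
  have "a < 4" "b < 4" using swap.hyps by auto
  then have "mset (rf_entries (permr r (Transposition.transpose a b))) = mset (rf_entries r)"
    by (intro mset_rf_entries_transpose swap.prems)
  moreover have "mset (rf_entries (permr (permr r (Transposition.transpose a b)) p)) =
      mset (rf_entries (permr r (Transposition.transpose a b)))"
    by (rule swap.IH) fact+
  ultimately show ?case unfolding e by simp
qed

lemma card_zero_pairs_mset:
  "card (zero_pairs r) = size {#x \<in># mset (rf_entries r). x = 0#}"
  by (simp add: card_zero_pairs flip: size_mset)

lemma zeros_same_column_relabel_imp:
  assumes sym: "\<And>i j. r i j = r j i" and \<tau>: "\<tau> permutes {..<4}" and z: "zeros_same_column r"
  shows "zeros_same_column (permr r \<tau>)"
proof -
  have sym': "permr r \<tau> i j = permr r \<tau> j i" for i j unfolding permr_def by (rule sym)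
  have l: "\<tau> k < 4" if "k < 4" for k using permutes_in_image[OF \<tau>, of k] that by simp
  have i: "\<tau> a \<noteq> \<tau> b" if "a \<noteq> b" for a b using permutes_inj[OF \<tau>] that by (auto dest: injD)
  show ?thesis
    unfolding zeros_same_column_iff[of "permr r \<tau>", OF sym'] permr_def
  proof (intro allI impI)
    fix a b c :: nat
    assume "a < 4" "b < 4" "c < 4" "a \<noteq> b" "a \<noteq> c" "b \<noteq> c" "r (\<tau> a) (\<tau> b) = 0"
    then show "r (\<tau> a) (\<tau> c) \<noteq> 0"
      using z[unfolded zeros_same_column_iff[of r, OF sym], rule_format, of "\<tau> a" "\<tau> b" "\<tau> c"] l i by simp
  qed
qed

lemma zeros_same_column_relabel:
  assumes sym: "\<And>i j. r i j = r j i" and \<tau>: "\<tau> permutes {..<4}"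
  shows "zeros_same_column (permr r \<tau>) \<longleftrightarrow> zeros_same_column r"
proof
  assume *: "zeros_same_column (permr r \<tau>)"
  have "zeros_same_column (permr (permr r \<tau>) (inv \<tau>))"
  proof (rule zeros_same_column_relabel_imp[OF _ permutes_inv[OF \<tau>] *])
    show "permr r \<tau> i j = permr r \<tau> j i" for i j unfolding permr_def by (rule sym)
  qed
  also have "permr (permr r \<tau>) (inv \<tau>) = r"
    by (intro ext) (simp add: permr_def permutes_inverses[OF \<tau>])
  finally show "zeros_same_column r" .
qed (rule zeros_same_column_relabel_imp[OF sym \<tau>])

lemma sort_filter_cong:
  assumes "mset xs = mset ys"
  shows "sort (filter P xs) = sort (filter P ys)"
  by (rule properties_for_sort) (simp_all add: assms)

text \<open>Left multiplication by \<open>\<tau>\<close> is a bijection on the permutations of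
  \<open>S\<close>, with inverse left multiplication by \<open>inv \<tau>\<close>.\<close>

lemma ex_permutes_relabel:
  assumes \<tau>: "\<tau> permutes S"
  shows "(\<exists>\<sigma>. \<sigma> permutes S \<and> P (\<tau> \<circ> \<sigma>)) \<longleftrightarrow> (\<exists>\<sigma>. \<sigma> permutes S \<and> P \<sigma>)"
proof -
  have "\<tau> \<circ> (inv \<tau> \<circ> \<sigma>) = \<sigma>" for \<sigma>
    using permutes_inv_o[OF \<tau>] by (simp add: o_assoc)
  then show ?thesis
    using permutes_compose[OF _ \<tau>] permutes_compose[OF _ permutes_inv[OF \<tau>]] by metis
qed

lemma normal_forms_permr:
  assumes "\<tau> permutes {..<4}"
  shows "normal_forms N (permr r \<tau>) = normal_forms N r"
proof -
  have "permr (permr r \<tau>) \<sigma> = permr r (\<tau> \<circ> \<sigma>)" for \<sigma> by (simp add: permr_def[abs_def])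
  then show ?thesis
    unfolding normal_forms_def using ex_permutes_relabel[OF assms, of "\<lambda>\<sigma>. N (permr r \<sigma>) y" for y] by simp
qed

lemma root_inv_of_permr:
  assumes sym: "\<And>i j. r i j = r j i" and \<tau>: "\<tau> permutes {..<4}"
  shows "root_inv_of (permr r \<tau>) = root_inv_of r"
proof -
  have m: "mset (rf_entries (permr r \<tau>)) = mset (rf_entries r)"
    by (rule mset_rf_entries_relabel[OF sym \<tau>])
  have c: "card (zero_pairs (permr r \<tau>)) = card (zero_pairs r)"
    unfolding card_zero_pairs_mset m ..
  have z: "zeros_same_column (permr r \<tau>) \<longleftrightarrow> zeros_same_column r"
    by (rule zeros_same_column_relabel[OF sym \<tau>])
  show ?thesis
    unfolding root_inv_of_def c z sort_filter_cong[OF m] normal_forms_permr[OF \<tau>] ..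
qed

lemma rf_entries_eq_iff:
  "rf_entries r = rf_entries s \<longleftrightarrow>
    r 2 3 = s 2 3 \<and> r 1 3 = s 1 3 \<and> r 1 2 = s 1 2 \<and> r 0 1 = s 0 1 \<and> r 0 2 = s 0 2 \<and> r 0 3 = s 0 3"
  by (simp add: rf_entries_def)

text \<open>Everything is computed from the six root form entries, and a permutation carries
  distinct indices below 4 to distinct indices below 4. The form suits matrices whose diagonals are
  not compared.\<close>

lemma root_inv_of_cong:
  assumes eq: "\<And>i j. i < 4 \<Longrightarrow> j < 4 \<Longrightarrow> i \<noteq> j \<Longrightarrow> r i j = s i j"
  shows "root_inv_of r = root_inv_of s"
proof -
  have rf: "rf_entries r = rf_entries s"
    unfolding rf_entries_eq_iff by (intro conjI eq) simp_all
  have z: "zero_pairs r = zero_pairs s"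
  proof -
    have "r i j = 0 \<longleftrightarrow> s i j = 0" if "i < j" "j < 4" for i j
      using eq[of i j] that by simp
    then show ?thesis unfolding zero_pairs_def by blast
  qed
  have zc: "zeros_same_column r = zeros_same_column s"
    unfolding zeros_same_column_def z ..
  have rf_permr: "rf_entries (permr r \<sigma>) = rf_entries (permr s \<sigma>)" if \<sigma>: "\<sigma> permutes {..<4}" for \<sigma>
  proof -
    have "\<sigma> k < 4" if "k < 4" for k using permutes_in_image[OF \<sigma>, of k] that by simp
    moreover have "\<sigma> i \<noteq> \<sigma> j" if "i \<noteq> j" for i j using permutes_inj[OF \<sigma>] that by (auto dest: injD)
    ultimately show ?thesis
      unfolding rf_entries_eq_iff permr_def by (intro conjI eq) simp_all
  qed
  have N: "normal_forms N r = normal_forms N s"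
    if "\<And>a b y. rf_entries a = rf_entries b \<Longrightarrow> N a y = N b y" for N
    unfolding normal_forms_def using that rf_permr by blast
  have "normal_forms normal4 r = normal_forms normal4 s"
    by (rule N) (simp add: normal4_def rf_entries_eq_iff)
  moreover have "normal_forms normal2 r = normal_forms normal2 s"
  proof (rule N)
    fix a b :: "nat \<Rightarrow> nat \<Rightarrow> real" and y
    assume e: "rf_entries a = rf_entries b"
    then have "square_corners a = square_corners b"
      by (simp add: square_corners_def rf_entries_eq_iff)
    then show "normal2 a y = normal2 b y"
      using e by (simp add: normal2_def rf_entries_eq_iff)
  qed
  moreover have "normal_forms normal1 r = normal_forms normal1 s"
  proof (rule N)
    fix a b :: "nat \<Rightarrow> nat \<Rightarrow> real" and y
    assume e: "rf_entries a = rf_entries b"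
    show "normal1 a y = normal1 b y"
      unfolding normal1_def e using e[unfolded rf_entries_eq_iff] by simp
  qed
  ultimately show ?thesis
    unfolding root_inv_of_def rf z zc by (simp only:)
qed

text \<open>The effect of Selling's step on root products when \<open>r 2 3 = 0\<close>: the entries at (0, 2) and (1, 2)
  are exchanged. Together with the index permutations fixing the zero this generates all
  symmetries of the square of corners, which is why the \<open>V\<^sub>2\<close> case allows them all.\<close>

definition flipped :: "(nat \<Rightarrow> nat \<Rightarrow> real) \<Rightarrow> (nat \<Rightarrow> nat \<Rightarrow> real) \<Rightarrow> bool" where
  "flipped r s \<longleftrightarrow> (\<forall>i j. r i j = r j i) \<and> (\<forall>i j. s i j = s j i) \<and> r 2 3 = 0 \<and> s 2 3 = 0 \<and>
     s 0 1 = r 0 1 \<and> s 0 3 = r 0 3 \<and> s 1 3 = r 1 3 \<and> s 0 2 = r 1 2 \<and> s 1 2 = r 0 2"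

lemma flippedD:
  assumes "flipped r s"
  shows "r 2 3 = 0" "s 2 3 = 0" "s 0 1 = r 0 1" "s 0 3 = r 0 3" "s 1 3 = r 1 3" "s 0 2 = r 1 2" "s 1 2 = r 0 2"
  using assms unfolding flipped_def by blast+

lemma flipped_sym:
  assumes "flipped r s"
  shows "r 1 0 = r 0 1" "r 2 0 = r 0 2" "r 3 0 = r 0 3" "r 2 1 = r 1 2" "r 3 1 = r 1 3" "r 3 2 = r 2 3"
    "s 1 0 = s 0 1" "s 2 0 = s 0 2" "s 3 0 = s 0 3" "s 2 1 = s 1 2" "s 3 1 = s 1 3" "s 3 2 = s 2 3"
proof -
  have "r i j = r j i" "s i j = s j i" for i j using assms unfolding flipped_def by blast+
  then show "r 1 0 = r 0 1" "r 2 0 = r 0 2" "r 3 0 = r 0 3" "r 2 1 = r 1 2" "r 3 1 = r 1 3" "r 3 2 = r 2 3"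
    "s 1 0 = s 0 1" "s 2 0 = s 0 2" "s 3 0 = s 0 3" "s 2 1 = s 1 2" "s 3 1 = s 1 3" "s 3 2 = s 2 3"
    by blast+
qed

lemma flipped_commute: "flipped r s \<Longrightarrow> flipped s r"
  unfolding flipped_def by auto

lemma permutes_less4_cases:
  assumes "\<sigma> permutes {..<4}"
  shows "\<sigma> 0 < 4 \<and> \<sigma> 1 < 4 \<and> \<sigma> 2 < 4 \<and> \<sigma> 3 < (4::nat)" "distinct [\<sigma> 0, \<sigma> 1, \<sigma> 2, \<sigma> 3]"
proof -
  have "\<sigma> k < 4" if "k < 4" for k using permutes_in_image[OF assms, of k] that by simp
  then show "\<sigma> 0 < 4 \<and> \<sigma> 1 < 4 \<and> \<sigma> 2 < 4 \<and> \<sigma> 3 < (4::nat)" by simp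
  have "\<sigma> i \<noteq> \<sigma> j" if "i \<noteq> j" for i j using permutes_inj[OF assms] that by (auto dest: injD)
  then show "distinct [\<sigma> 0, \<sigma> 1, \<sigma> 2, \<sigma> 3]" by simp
qed

lemma less4_cases4:
  fixes a b c d :: nat
  assumes "a < 4 \<and> b < 4 \<and> c < 4 \<and> d < 4" "distinct [a, b, c, d]"
  shows "a = 0 \<and> b = 1 \<and> c = 2 \<and> d = 3 \<or> a = 0 \<and> b = 1 \<and> c = 3 \<and> d = 2 \<or>
    a = 0 \<and> b = 2 \<and> c = 1 \<and> d = 3 \<or> a = 0 \<and> b = 2 \<and> c = 3 \<and> d = 1 \<or>
    a = 0 \<and> b = 3 \<and> c = 1 \<and> d = 2 \<or> a = 0 \<and> b = 3 \<and> c = 2 \<and> d = 1 \<or>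
    a = 1 \<and> b = 0 \<and> c = 2 \<and> d = 3 \<or> a = 1 \<and> b = 0 \<and> c = 3 \<and> d = 2 \<or>
    a = 1 \<and> b = 2 \<and> c = 0 \<and> d = 3 \<or> a = 1 \<and> b = 2 \<and> c = 3 \<and> d = 0 \<or>
    a = 1 \<and> b = 3 \<and> c = 0 \<and> d = 2 \<or> a = 1 \<and> b = 3 \<and> c = 2 \<and> d = 0 \<or>
    a = 2 \<and> b = 0 \<and> c = 1 \<and> d = 3 \<or> a = 2 \<and> b = 0 \<and> c = 3 \<and> d = 1 \<or>
    a = 2 \<and> b = 1 \<and> c = 0 \<and> d = 3 \<or> a = 2 \<and> b = 1 \<and> c = 3 \<and> d = 0 \<or>
    a = 2 \<and> b = 3 \<and> c = 0 \<and> d = 1 \<or> a = 2 \<and> b = 3 \<and> c = 1 \<and> d = 0 \<or>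
    a = 3 \<and> b = 0 \<and> c = 1 \<and> d = 2 \<or> a = 3 \<and> b = 0 \<and> c = 2 \<and> d = 1 \<or>
    a = 3 \<and> b = 1 \<and> c = 0 \<and> d = 2 \<or> a = 3 \<and> b = 1 \<and> c = 2 \<and> d = 0 \<or>
    a = 3 \<and> b = 2 \<and> c = 0 \<and> d = 1 \<or> a = 3 \<and> b = 2 \<and> c = 1 \<and> d = 0"
  using assms unfolding less4_iff by (elim conjE disjE) simp_all

text \<open>The zeros at \<open>{c, d}\<close> and \<open>{b, d}\<close> meet at \<open>d\<close>,
  which is 2 or 3. If \<open>d = 3\<close>, the flip keeps all entries at index 3 and permutes the
  triple on 0, 1, 2. If \<open>d = 2\<close>, it exchanges the entries (0, 2) and (1, 2);
  transposing 0 and 1 undoes this and only permutes the triple on 0, 1, 3.\<close>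

lemma flipped_normal4_step:
  assumes fl: "flipped r s" and two: "card (zero_pairs r) = 2"
    and perm: "a < 4 \<and> b < 4 \<and> c < 4 \<and> d < 4" "distinct [a, b, c, d]"
    and z: "r c d = 0" "r b d = 0"
    and t: "t = (if d = 3 then id else Transposition.transpose 0 1)"
  shows "s (t c) (t d) = 0 \<and> s (t b) (t d) = 0 \<and> s (t a) (t d) = r a d \<and>
    {#s (t b) (t c), s (t a) (t b), s (t a) (t c)#} = {#r b c, r a b, r a c#}"
proof -
  note f = flippedD[OF fl]
  note rs = flipped_sym[OF fl]
  have "length (filter (\<lambda>x. x = 0) [r 1 3, r 1 2, r 0 1, r 0 2, r 0 3]) = 1"
    using two f(1) by (simp add: card_zero_pairs rf_entries_def)
  then have uniq: "\<not> (r 1 3 = 0 \<and> r 1 2 = 0)" "\<not> (r 1 3 = 0 \<and> r 0 1 = 0)" "\<not> (r 1 3 = 0 \<and> r 0 2 = 0)"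
    "\<not> (r 1 3 = 0 \<and> r 0 3 = 0)" "\<not> (r 1 2 = 0 \<and> r 0 1 = 0)" "\<not> (r 1 2 = 0 \<and> r 0 2 = 0)"
    "\<not> (r 1 2 = 0 \<and> r 0 3 = 0)" "\<not> (r 0 1 = 0 \<and> r 0 2 = 0)" "\<not> (r 0 1 = 0 \<and> r 0 3 = 0)"
    "\<not> (r 0 2 = 0 \<and> r 0 3 = 0)"
    by (auto split: if_splits)
  \<comment> \<open>Besides (2, 3) there is just one zero, so one of the pairs
    \<open>{c, d}\<close>, \<open>{b, d}\<close> is \<open>{2, 3}\<close>; eight arrangements
    remain.\<close>
  have "[a, b, c, d] \<in> set [[0,1,2,3], [0,2,1,3], [1,0,2,3], [1,2,0,3], [0,1,3,2], [0,3,1,2], [1,0,3,2], [1,3,0,2]]"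
    using uniq z perm(2) less4_cases4[OF perm] by (elim disjE conjE) (simp_all add: rs del: One_nat_def)
  then show ?thesis
    using z t by (simp del: One_nat_def)
      (elim disjE conjE; simp add: f rs Transposition.transpose_def add_mset_commute del: One_nat_def)
qed

lemma flipped_normal4:
  assumes fl: "flipped r s" and two: "card (zero_pairs r) = 2"
  shows "normal_forms normal4 r \<subseteq> normal_forms normal4 s"
proof
  fix y assume "y \<in> normal_forms normal4 r"
  then obtain \<sigma> where \<sigma>: "\<sigma> permutes {..<4}" and n: "normal4 (permr r \<sigma>) y"
    unfolding normal_forms_def by blast
  define t where "t = (if \<sigma> 3 = 3 then id else Transposition.transpose 0 (1::nat))"
  have t\<sigma>: "t \<circ> \<sigma> permutes {..<4}"
    unfolding t_def by (rule permutes_compose[OF \<sigma>]) (simp add: permutes_swap_id permutes_id)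
  \<comment> \<open>The sorted triple depends only on its multiset, which is what the preceding case
    analysis preserves.\<close>
  have S: "sort [a, b, c] = sorted_list_of_multiset {#a, b, c#}" for a b c :: real
    by (metis mset.simps sorted_list_of_multiset_mset)
  have "normal4 (permr s (t \<circ> \<sigma>)) y"
    using flipped_normal4_step[OF fl two permutes_less4_cases[OF \<sigma>] _ _ t_def] n
    unfolding normal4_def permr_def S comp_def by metis
  then show "y \<in> normal_forms normal4 s"
    unfolding normal_forms_def using t\<sigma> by blast
qed

text \<open>Since 3 is -1 modulo 4, the map \<open>k \<mapsto> m + 3 * k\<close> is the reflection
  taking \<open>k\<close> to \<open>m - k\<close>; composed with a rotation or reflection of the
  square it gives another symmetry.\<close>

lemma square_sym_reflect:
  assumes "square_sym g"
  shows "square_sym (\<lambda>k. (m + 3 * g k) mod 4)"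
proof -
  have red: "(m + 3 * (n mod 4)) mod 4 = (m + 3 * n) mod 4" for n
    by (metis mod_add_right_eq mod_mult_right_eq)
  have 1: "(m + 3 * ((a + k) mod 4)) mod 4 = ((m + 3 * a) mod 4 + 3 * k) mod 4" for a k
    unfolding red by (simp add: mod_simps algebra_simps)
  have 2: "(m + 3 * ((a + 3 * k) mod 4)) mod 4 = ((m + 3 * a) mod 4 + k) mod 4" for a k
  proof -
    have "(m + 3 * ((a + 3 * k) mod 4)) mod 4 = (m + 3 * a + k + 4 * (2 * k)) mod 4"
      unfolding red by (simp add: algebra_simps)
    also have "\<dots> = ((m + 3 * a) mod 4 + k) mod 4"
      by (simp only: mod_mult_self2 mod_add_left_eq)
    finally show ?thesis .
  qed
  obtain a where "a < 4" "(\<forall>k. g k = (a + k) mod 4) \<or> (\<forall>k. g k = (a + 3 * k) mod 4)"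
    using assms unfolding square_sym_def by blast
  then have "(\<forall>k. (m + 3 * g k) mod 4 = ((m + 3 * a) mod 4 + 3 * k) mod 4) \<or>
      (\<forall>k. (m + 3 * g k) mod 4 = ((m + 3 * a) mod 4 + k) mod 4)"
  proof (elim disjE)
    assume "\<forall>k. g k = (a + k) mod 4"
    then show ?thesis by (simp only: 1 simp_thms)
  next
    assume "\<forall>k. g k = (a + 3 * k) mod 4"
    then show ?thesis by (simp only: 2 simp_thms)
  qed
  moreover have "(m + 3 * a) mod 4 < 4" by simp
  ultimately show ?thesis unfolding square_sym_def by blast
qed

text \<open>The only zero is at (2, 3), so \<open>\<sigma>\<close> preserves \<open>{2, 3}\<close>
  and \<open>{0, 1}\<close>. The flip then exchanges two opposite corners of the square, a
  reflection that the choice of \<open>g\<close> absorbs.\<close>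

lemma flipped_normal2:
  assumes fl: "flipped r s" and one: "card (zero_pairs r) = 1"
  shows "normal_forms normal2 r \<subseteq> normal_forms normal2 s"
proof
  fix y assume "y \<in> normal_forms normal2 r"
  then obtain \<sigma> g where \<sigma>: "\<sigma> permutes {..<4}" and z: "permr r \<sigma> 2 3 = 0" and g: "square_sym g"
    and min: "\<forall>k<4. square_corners (permr r \<sigma>) (g 0) \<le> square_corners (permr r \<sigma>) (g k)"
    and le: "square_corners (permr r \<sigma>) (g 1) \<le> square_corners (permr r \<sigma>) (g 3)"
    and y: "y = RI2 (permr r \<sigma> 0 1) (map (square_corners (permr r \<sigma>) \<circ> g) [0, 1, 3])
      (square_corners (permr r \<sigma>) (g 2))"
    unfolding normal_forms_def normal2_def by blast
  note f = flippedD[OF fl]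
  note rs = flipped_sym[OF fl]
  have "r 1 3 \<noteq> 0 \<and> r 1 2 \<noteq> 0 \<and> r 0 1 \<noteq> 0 \<and> r 0 2 \<noteq> 0 \<and> r 0 3 \<noteq> 0"
    using one f(1) by (auto simp: card_zero_pairs rf_entries_def split: if_splits)
  then have cases: "(\<sigma> 2 = 2 \<and> \<sigma> 3 = 3 \<or> \<sigma> 2 = 3 \<and> \<sigma> 3 = 2) \<and> (\<sigma> 0 = 0 \<and> \<sigma> 1 = 1 \<or> \<sigma> 0 = 1 \<and> \<sigma> 1 = 0)"
    using less4_cases4[OF permutes_less4_cases[OF \<sigma>]] z[unfolded permr_def]
    by (elim disjE conjE) (simp_all add: rs del: One_nat_def)
  \<comment> \<open>The flip moves the entries at index 2. They are corners 1 and 3 if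
    \<open>\<sigma>\<close> fixes 2 and 3, and corners 0 and 2 if it exchanges them; the reflections
    are \<open>k\<close> to \<open>-k\<close> and \<open>k\<close> to \<open>2 - k\<close> modulo
    4.\<close>
  define m :: nat where "m = (if \<sigma> 3 = 3 then 0 else 2)"
  have refl: "square_corners (permr s \<sigma>) ((m + 3 * k) mod 4) = square_corners (permr r \<sigma>) k" if "k < 4" for k
    using cases that unfolding less4_iff
    by (elim disjE conjE) (simp_all add: m_def square_corners_def permr_def f rs del: One_nat_def)
  have g4: "g k < 4" for k using g unfolding square_sym_def by (metis mod_less_divisor zero_less_numeral)
  have z': "permr s \<sigma> 2 3 = 0" "permr s \<sigma> 0 1 = permr r \<sigma> 0 1"
    using cases by (auto simp: permr_def f rs simp del: One_nat_def)
  have "normal2 (permr s \<sigma>) y"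
    unfolding normal2_def
    using z' square_sym_reflect[OF g, of m] min le y
    by (intro conjI exI[of _ "\<lambda>k. (m + 3 * g k) mod 4"]) (simp_all add: refl g4)
  then show "y \<in> normal_forms normal2 s"
    unfolding normal_forms_def using \<sigma> by blast
qed

text \<open>One zero is at (2, 3), whose column partner is (0, 1), and the flip leaves that entry
  unchanged. The criterion is therefore the same for \<open>r\<close> and \<open>s\<close>.\<close>

lemma flipped_zeros_same_column:
  assumes fl: "flipped r s" and two: "card (zero_pairs r) = 2"
  shows "zeros_same_column s \<longleftrightarrow> r 0 1 = 0"
proof -
  note f = flippedD[OF fl]
  have zp: "zero_pairs s = {(i, j) \<in> {(2,3), (1,3), (1,2), (0,1), (0,2), (0,3)}. s i j = 0}"
    unfolding zero_pairs_def less4_iff by auto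
  have "length (filter (\<lambda>x. x = 0) [r 1 3, r 1 2, r 0 1, r 0 2, r 0 3]) = 1"
    using two f(1) by (simp add: card_zero_pairs rf_entries_def)
  then consider
      "r 0 1 = 0" "r 1 3 \<noteq> 0" "r 1 2 \<noteq> 0" "r 0 2 \<noteq> 0" "r 0 3 \<noteq> 0"
    | "r 0 1 \<noteq> 0" "r 1 3 = 0 \<or> r 1 2 = 0 \<or> r 0 2 = 0 \<or> r 0 3 = 0"
    by (auto split: if_splits)
  then show ?thesis
  proof cases
    case 1
    then have "zero_pairs s = {(2, 3), (0, 1)}" unfolding zp by (auto simp: f simp del: One_nat_def)
    then show ?thesis using 1 by (simp add: zeros_same_column_def)
  next
    case 2
    then have "(1, 3) \<in> zero_pairs s \<or> (1, 2) \<in> zero_pairs s \<or> (0, 2) \<in> zero_pairs s \<or> (0, 3) \<in> zero_pairs s"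
      unfolding zp by (auto simp: f simp del: One_nat_def)
    moreover have "(2, 3) \<in> zero_pairs s" unfolding zp by (simp add: f)
    ultimately have "\<not> zeros_same_column s" unfolding zeros_same_column_def by fastforce
    then show ?thesis using 2 by simp
  qed
qed

text \<open>The relation is symmetric, so one inclusion per normal form gives equality. The sorted
  lists depend only on the multiset of entries, and the zero at (2, 3) excludes V1.\<close>

lemma root_inv_of_flipped:
  assumes fl: "flipped r s"
  shows "root_inv_of s = root_inv_of r"
proof -
  note f = flippedD[OF fl]
  have m: "mset (rf_entries s) = mset (rf_entries r)"
    by (simp add: rf_entries_def f add_mset_commute del: One_nat_def)
  have c: "card (zero_pairs s) = card (zero_pairs r)"
    unfolding card_zero_pairs_mset m ..
  have z: "zeros_same_column s \<longleftrightarrow> zeros_same_column r" if "card (zero_pairs r) = 2"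
    using flipped_zeros_same_column[OF fl] flipped_zeros_same_column[OF flipped_commute[OF fl]] c that f by simp
  have n4: "normal_forms normal4 s = normal_forms normal4 r" if "card (zero_pairs r) = 2"
    using flipped_normal4[OF fl] flipped_normal4[OF flipped_commute[OF fl]] c that by auto
  have n2: "normal_forms normal2 s = normal_forms normal2 r" if "card (zero_pairs r) = 1"
    using flipped_normal2[OF fl] flipped_normal2[OF flipped_commute[OF fl]] c that by auto
  have n0: "card (zero_pairs r) \<noteq> 0"
    using f(1) by (simp add: card_zero_pairs rf_entries_def)
  show ?thesis
    unfolding root_inv_of_def Let_def c sort_filter_cong[OF m]
    using z n4 n2 n0 by simp
qed

section \<open>Comparison of obtuse superbases\<close>

lemma rootp_commute: "rootp v i j = rootp v j i"
  by (simp add: rootp_def conorm_commute)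

lemma RI_relabel:
  assumes \<tau>: "\<tau> permutes {..<4}"
    and eq: "\<And>i j. i < 4 \<Longrightarrow> j < 4 \<Longrightarrow> i \<noteq> j \<Longrightarrow> conorm w i j = conorm v (\<tau> i) (\<tau> j)"
  shows "RI w = RI v"
proof -
  have "root_inv_of (rootp w) = root_inv_of (permr (rootp v) \<tau>)"
    by (rule root_inv_of_cong) (simp add: permr_def rootp_def eq)
  also have "\<dots> = root_inv_of (rootp v)"
    by (rule root_inv_of_permr[OF rootp_commute \<tau>])
  finally show ?thesis by (simp only: RI_eq_root_inv_of)
qed

lemma superbase_permute:
  assumes v: "superbase v" and \<pi>: "\<pi> permutes {..<4}"
  shows "superbase (v \<circ> \<pi>)" "lattice_of (v \<circ> \<pi>) = lattice_of v"
proof -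
  \<comment> \<open>Vanishing of the sum of all four vectors is the form of the superbase condition
    that is symmetric in the indices.\<close>
  have "(\<Sum>k<4. (v \<circ> \<pi>) k) = (\<Sum>k<4. v k)"
    using sum.permute[OF \<pi>, of v] by simp
  also have "\<dots> = 0" unfolding sum_less4 superbase_zero[OF v] by simp
  finally have sum0: "(v \<circ> \<pi>) 0 + (v \<circ> \<pi>) 1 + (v \<circ> \<pi>) 2 + (v \<circ> \<pi>) 3 = 0"
    by (simp only: sum_less4)
  have "x0 = - (x1 + x2 + x3)" if "x0 + x1 + x2 + x3 = 0" for x0 x1 x2 x3 :: "real^3"
    using that by (simp only: eq_neg_iff_add_eq_0 add.assoc)
  from this[OF sum0] have zero: "(v \<circ> \<pi>) 0 = - ((v \<circ> \<pi>) 1 + (v \<circ> \<pi>) 2 + (v \<circ> \<pi>) 3)" .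
  have l: "\<pi> k < 4" if "k < 4" for k using permutes_in_image[OF \<pi>, of k] that by simp
  have "(v \<circ> \<pi>) k \<in> lattice_of v" if "k < 4" for k
    using superbase_mem_lattice[OF superbase_zero[OF v] l[OF that]] by (simp only: comp_apply)
  then have sub: "lattice_of (v \<circ> \<pi>) \<subseteq> lattice_of v"
    by (intro lattice_of_subset) simp_all
  have "v k \<in> lattice_of (v \<circ> \<pi>)" if "k < 4" for k
  proof -
    have "inv \<pi> k < 4" using permutes_in_image[OF permutes_inv[OF \<pi>], of k] that by simp
    moreover have "(v \<circ> \<pi>) (inv \<pi> k) = v k"
      by (simp only: comp_apply permutes_inverses[OF \<pi>])
    ultimately show ?thesis
      using superbase_mem_lattice[OF zero, of "inv \<pi> k"] by (simp only:)
  qed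
  then have "lattice_of v \<subseteq> lattice_of (v \<circ> \<pi>)"
    by (intro lattice_of_subset) simp_all
  with sub show L: "lattice_of (v \<circ> \<pi>) = lattice_of v" by blast
  show "superbase (v \<circ> \<pi>)" by (rule superbase_of_lattice[OF v zero L])
qed

lemma obtuse_permute:
  assumes "obtuse v" and \<pi>: "\<pi> permutes {..<4}"
  shows "obtuse (v \<circ> \<pi>)"
proof -
  have "\<pi> k < 4" if "k < 4" for k using permutes_in_image[OF \<pi>, of k] that by simp
  moreover have "\<pi> i \<noteq> \<pi> j" if "i \<noteq> j" for i j using permutes_inj[OF \<pi>] that by (auto dest: injD)
  ultimately show ?thesis
    using assms(1) unfolding obtuse_def conorm_def by simp
qed

text \<open>Selling's reduction step at the pair (2, 3). If \<open>v 2\<close> and \<open>v 3\<close> are orthogonal, it turns an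
  obtuse superbase into another one that is in general not an index permutation of the first.\<close>

definition flip :: "(nat \<Rightarrow> real^3) \<Rightarrow> nat \<Rightarrow> real^3" where
  "flip v k = (if k = 0 then v 0 + v 2 else if k = 1 then v 1 + v 2 else if k = 2 then - v 2 else v k)"

lemma flip_simps: "flip v 0 = v 0 + v 2" "flip v 1 = v 1 + v 2" "flip v 2 = - v 2" "flip v 3 = v 3"
  by (simp_all add: flip_def)

lemma superbase_flip:
  assumes v: "superbase v"
  shows "superbase (flip v)" "lattice_of (flip v) = lattice_of v"
proof -
  have zero: "flip v 0 = - (flip v 1 + flip v 2 + flip v 3)"
    unfolding flip_simps superbase_zero[OF v] by simp
  note m = superbase_mem_lattice[OF superbase_zero[OF v]]
  have "lattice_of (flip v) \<subseteq> lattice_of v"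
    by (rule lattice_of_subset; unfold flip_simps; intro lattice_of_add lattice_of_minus m; simp)
  moreover have "lattice_of v \<subseteq> lattice_of (flip v)"
  proof (rule lattice_of_subset)
    note m' = superbase_mem_lattice[of "flip v", OF zero]
    have "flip v 1 + flip v 2 \<in> lattice_of (flip v)" "- flip v 2 \<in> lattice_of (flip v)"
      "flip v 3 \<in> lattice_of (flip v)"
      by (intro lattice_of_add lattice_of_minus m'; simp)+
    then show "v 1 \<in> lattice_of (flip v)" "v 2 \<in> lattice_of (flip v)" "v 3 \<in> lattice_of (flip v)"
      unfolding flip_simps by simp_all
  qed
  ultimately show L: "lattice_of (flip v) = lattice_of v" by blast
  show "superbase (flip v)" by (rule superbase_of_lattice[OF v zero L])
qed

text \<open>For instance, as \<open>v 2\<close> and \<open>v 3\<close> are orthogonal, \<open>(v 1 +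
  v 2) \<bullet> v 2 = - ((v 0 + v 3) \<bullet> v 2) = conorm v 0 2\<close>.\<close>

lemma conorm_flip:
  assumes v: "superbase v" and 0: "conorm v 2 3 = 0"
  shows "conorm (flip v) 0 1 = conorm v 0 1" "conorm (flip v) 2 3 = 0" "conorm (flip v) 0 3 = conorm v 0 3"
    "conorm (flip v) 1 3 = conorm v 1 3" "conorm (flip v) 0 2 = conorm v 1 2" "conorm (flip v) 1 2 = conorm v 0 2"
proof -
  define a b c where abc: "a = v 1" "b = v 2" "c = v 3"
  have v0: "v 0 = - (a + b + c)" using superbase_zero[OF v] abc by simp
  have comm: "b \<bullet> a = a \<bullet> b" "c \<bullet> a = a \<bullet> c" "c \<bullet> b = b \<bullet> c" by (rule inner_commute)+
  have "b \<bullet> c = 0" using 0 by (simp add: conorm_def abc)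
  then show "conorm (flip v) 0 1 = conorm v 0 1" "conorm (flip v) 2 3 = 0" "conorm (flip v) 0 3 = conorm v 0 3"
    "conorm (flip v) 1 3 = conorm v 1 3" "conorm (flip v) 0 2 = conorm v 1 2" "conorm (flip v) 1 2 = conorm v 0 2"
    unfolding conorm_def flip_simps v0 abc[symmetric]
    by (simp_all add: inner_add_left inner_add_right inner_diff_left inner_diff_right comm)
qed

lemma obtuse_flip:
  assumes v: "superbase v" and "obtuse v" and 0: "conorm v 2 3 = 0"
  shows "obtuse (flip v)"
proof -
  have p: "conorm v i j \<ge> 0" if "i < 4" "j < 4" "i \<noteq> j" for i j
    using assms(2) that by (auto simp: obtuse_def)
  have q: "conorm (flip v) 0 1 \<ge> 0" "conorm (flip v) 2 3 \<ge> 0" "conorm (flip v) 0 3 \<ge> 0"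
    "conorm (flip v) 1 3 \<ge> 0" "conorm (flip v) 0 2 \<ge> 0" "conorm (flip v) 1 2 \<ge> 0"
    unfolding conorm_flip[OF v 0] by (intro p order_refl; simp)+
  then have "conorm (flip v) 1 0 \<ge> 0" "conorm (flip v) 3 2 \<ge> 0" "conorm (flip v) 3 0 \<ge> 0"
    "conorm (flip v) 3 1 \<ge> 0" "conorm (flip v) 2 0 \<ge> 0" "conorm (flip v) 2 1 \<ge> 0"
    by (simp_all only: conorm_commute[of "flip v" 1 0] conorm_commute[of "flip v" 3 2]
      conorm_commute[of "flip v" 3 0] conorm_commute[of "flip v" 3 1]
      conorm_commute[of "flip v" 2 0] conorm_commute[of "flip v" 2 1])
  with q show ?thesis unfolding obtuse_def less4_iff by blast
qed

lemma RI_flip: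
  assumes v: "superbase v" and 0: "conorm v 2 3 = 0"
  shows "RI (flip v) = RI v"
  unfolding RI_eq_root_inv_of
proof (rule root_inv_of_flipped)
  show "flipped (rootp v) (rootp (flip v))"
    unfolding flipped_def rootp_def conorm_flip[OF v 0] 0
    by (intro conjI allI refl arg_cong[where f = sqrt] conorm_commute) simp_all
qed

text \<open>Applied below to representatives modulo \<open>2L\<close>: the left side runs over the four odd classes of
  \<open>L/2L\<close>, the right side over the three non-zero even ones.\<close>

lemma zero_sum_norms:
  fixes a b c d :: "'a::real_inner"
  assumes "a + b + c + d = 0"
  shows "(norm a)\<^sup>2 + (norm b)\<^sup>2 + (norm c)\<^sup>2 + (norm d)\<^sup>2 =
    (norm (a + b))\<^sup>2 + (norm (a + c))\<^sup>2 + (norm (a + d))\<^sup>2"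
proof -
  have d: "d = - (a + b + c)" using assms by (metis eq_neg_iff_add_eq_0 add.commute)
  show ?thesis
    unfolding d power2_norm_eq_inner by (simp add: inner_simps inner_commute)
qed

text \<open>As \<open>flip w\<close> is not yet known to be obtuse, minimality is used for partial
  sums of \<open>w\<close> itself: \<open>w 0 + w 2\<close>, \<open>w 1 + w 2\<close>,
  \<open>w 2\<close>, \<open>w 3\<close> represent the odd classes and \<open>w 0 + w 1\<close>,
  \<open>w 0\<close>, \<open>w 1\<close> the non-zero even ones. Their norms agree with those of the
  matching sums of \<open>v\<close>, where the odd and even totals are equal; for \<open>w\<close>
  the totals differ by \<open>4 * conorm w 2 3\<close>.\<close>

lemma conorm_zero_of_flip_congruent:
  assumes v: "superbase v" "obtuse v" and w: "superbase w" "obtuse w" and L: "lattice_of w = lattice_of v"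
    and \<tau>: "\<tau> permutes {..<4}" "\<And>k. k < 4 \<Longrightarrow> \<exists>t\<in>lattice_of v. flip w k = v (\<tau> k) + 2 *\<^sub>R t"
  shows "conorm w 2 3 = 0"
proof -
  have \<tau>l: "\<tau> k < 4" if "k < 4" for k using permutes_in_image[OF \<tau>(1), of k] that by simp
  have ne: "\<tau> i \<noteq> \<tau> j" if "i \<noteq> j" for i j using permutes_inj[OF \<tau>(1)] that by (auto dest: injD)
  have "\<exists>t. \<forall>k<4. t k \<in> lattice_of v \<and> flip w k = v (\<tau> k) + 2 *\<^sub>R t k"
    using \<tau>(2) by metis
  then obtain t where t: "\<And>k. k < 4 \<Longrightarrow> t k \<in> lattice_of v" "\<And>k. k < 4 \<Longrightarrow> flip w k = v (\<tau> k) + 2 *\<^sub>R t k"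
    by blast
  have w2: "w 2 \<in> lattice_of v" using superbase_mem_lattice[OF superbase_zero[OF w(1)]] L by simp
  have w1: "w 1 \<in> lattice_of v" using superbase_mem_lattice[OF superbase_zero[OF w(1)]] L by simp
  note eq = cut_vector_norm_eq[OF v w L]
  have one: "norm (sum w T) = norm (v (\<tau> k))"
    if "k < 4" "T \<subseteq> {..<4}" "x \<in> lattice_of v" "sum w T = flip w k + 2 *\<^sub>R x" for k T x
    using eq[of "{\<tau> k}" T "t k + x"] that t(1)[OF that(1)] t(2)[OF that(1)] \<tau>l[OF that(1)]
    by (simp add: lattice_of_add scaleR_add_right)
  have two: "norm (sum w T) = norm (v (\<tau> 0) + v (\<tau> k))"
    if "k < 4" "k \<noteq> 0" "T \<subseteq> {..<4}" "x \<in> lattice_of v" "sum w T = flip w 0 + flip w k + 2 *\<^sub>R x" for k T x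
    using eq[of "{\<tau> 0, \<tau> k}" T "t 0 + t k + x"] that t(1)[OF that(1)] t(2)[OF that(1)] t(1)[of 0] t(2)[of 0]
      \<tau>l[OF that(1)] \<tau>l[of 0] ne[of 0 k]
    by (simp add: lattice_of_add scaleR_add_right)
  have n: "norm (w 0 + w 2) = norm (v (\<tau> 0))" "norm (w 1 + w 2) = norm (v (\<tau> 1))"
    "norm (w 2) = norm (v (\<tau> 2))" "norm (w 3) = norm (v (\<tau> 3))"
    using one[of 0 "{0, 2}" 0] one[of 1 "{1, 2}" 0] one[of 2 "{2}" "w 2"] one[of 3 "{3}" 0] w2 lattice_of_0[of v]
    unfolding flip_simps by (simp_all add: scaleR_2)
  \<comment> \<open>Here \<open>flip w 0\<close> plus \<open>flip w 1\<close>,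
    \<open>flip w 2\<close>, \<open>flip w 3\<close> is \<open>w 0 + w 1 + 2 *\<^sub>R w 2\<close>,
    \<open>w 0\<close> and \<open>- w 1\<close>; hence the corrections \<open>- w 2\<close>, 0 and
    \<open>w 1\<close>.\<close>
  have n': "norm (w 0 + w 1) = norm (v (\<tau> 0) + v (\<tau> 1))" "norm (w 0) = norm (v (\<tau> 0) + v (\<tau> 2))"
    "norm (w 1) = norm (v (\<tau> 0) + v (\<tau> 3))"
    using two[of 1 "{0, 1}" "- w 2"] two[of 2 "{0}" 0] two[of 3 "{1}" "w 1"] w1 w2
      lattice_of_0[of v] lattice_of_minus[OF w2] superbase_zero[OF w(1)]
    unfolding flip_simps by (simp_all add: scaleR_2)
  have "(\<Sum>k<4. v (\<tau> k)) = (\<Sum>k<4. v k)"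
    using sum.permute[OF \<tau>(1), of v] by simp
  also have "\<dots> = 0" unfolding sum_less4 superbase_zero[OF v(1)] by simp
  finally have "(norm (w 0 + w 2))\<^sup>2 + (norm (w 1 + w 2))\<^sup>2 + (norm (w 2))\<^sup>2 + (norm (w 3))\<^sup>2 =
      (norm (w 0 + w 1))\<^sup>2 + (norm (w 0))\<^sup>2 + (norm (w 1))\<^sup>2"
    unfolding n n' by (intro zero_sum_norms) (simp only: sum_less4)
  moreover have "(norm (w 0 + w 2))\<^sup>2 + (norm (w 1 + w 2))\<^sup>2 + (norm (w 2))\<^sup>2 + (norm (w 3))\<^sup>2 -
      ((norm (w 0 + w 1))\<^sup>2 + (norm (w 0))\<^sup>2 + (norm (w 1))\<^sup>2) = 4 * conorm w 2 3"
  proof -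
    define a b c where abc: "a = w 1" "b = w 2" "c = w 3"
    have w0: "w 0 = - (a + b + c)" using superbase_zero[OF w(1)] abc by simp
    have comm: "b \<bullet> a = a \<bullet> b" "c \<bullet> a = a \<bullet> c" "c \<bullet> b = b \<bullet> c" by (rule inner_commute)+
    show ?thesis
      unfolding conorm_def w0 abc[symmetric] power2_norm_eq_inner
      by (simp add: inner_add_left inner_add_right inner_diff_left inner_diff_right comm)
  qed
  ultimately show ?thesis by simp
qed

lemma RI_odd:
  assumes v: "superbase v" "obtuse v" and w: "superbase w" "obtuse w" and L: "lattice_of w = lattice_of v"
    and g: "linear g" "g (v 1) = 1" "g (v 2) = 1" "g (v 3) = (1::real)"
    and odd: "\<And>k. k < 4 \<Longrightarrow> \<exists>n. g (w k) = of_int n \<and> odd n"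
  shows "RI w = RI v"
proof -
  obtain \<tau> where \<tau>: "\<tau> permutes {..<4}" "\<And>k. k < 4 \<Longrightarrow> \<exists>t\<in>lattice_of v. w k = v (\<tau> k) + 2 *\<^sub>R t"
    using odd_superbase_permutation[OF v(1) w(1) L g odd] by blast
  show ?thesis
    by (rule RI_relabel[OF \<tau>(1)]) (rule conorm_congruent_superbase[OF v w L \<tau>])
qed

text \<open>The zero sum makes the number of odd entries even; as it is neither 0 nor 4, it is 2,
  and the odd entries can be moved to positions 2 and 3.\<close>

lemma exists_permutation_two_odd:
  fixes n :: "nat \<Rightarrow> int"
  assumes "n 0 + n 1 + n 2 + n 3 = 0" "\<exists>k<4. odd (n k)" "\<exists>k<4. even (n k)"
  obtains \<pi> where "\<pi> permutes {..<4}" "even (n (\<pi> 0))" "even (n (\<pi> 1))" "odd (n (\<pi> 2))" "odd (n (\<pi> 3))"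
proof -
  have "even (n 0 + n 1 + n 2 + n 3)" using assms(1) by simp
  then consider
      "odd (n 2)" "odd (n 3)" "even (n 0)" "even (n 1)"
    | "odd (n 1)" "odd (n 3)" "even (n 0)" "even (n 2)"
    | "odd (n 1)" "odd (n 2)" "even (n 0)" "even (n 3)"
    | "odd (n 0)" "odd (n 3)" "even (n 1)" "even (n 2)"
    | "odd (n 0)" "odd (n 2)" "even (n 1)" "even (n 3)"
    | "odd (n 0)" "odd (n 1)" "even (n 2)" "even (n 3)"
    using assms(2,3) unfolding less4_iff even_add by blast
  then show ?thesis
  proof cases
    case 1 then show ?thesis by (intro that[of id]) (simp_all add: permutes_id)
  next
    case 2 then show ?thesis
      by (intro that[of "Transposition.transpose 1 2"]) (simp_all add: permutes_swap_id Transposition.transpose_def)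
  next
    case 3 then show ?thesis
      by (intro that[of "Transposition.transpose 1 3"]) (simp_all add: permutes_swap_id Transposition.transpose_def)
  next
    case 4 then show ?thesis
      by (intro that[of "Transposition.transpose 0 2"]) (simp_all add: permutes_swap_id Transposition.transpose_def)
  next
    case 5 then show ?thesis
      by (intro that[of "Transposition.transpose 0 3"]) (simp_all add: permutes_swap_id Transposition.transpose_def)
  next
    case 6 then show ?thesis
      by (intro that[of "Transposition.transpose 0 2 \<circ> Transposition.transpose 1 3"])
        (simp_all add: permutes_swap_id permutes_compose Transposition.transpose_def)
  qed
qed

lemma RI_eq_of_lattice_eq:
  assumes v: "superbase v" "obtuse v" and w: "superbase w" "obtuse w" and L: "lattice_of w = lattice_of v"
  shows "RI w = RI v"
proof -
  \<comment> \<open>Modulo 2, \<open>g\<close> is the functional on \<open>L/2L\<close> taking the value 1 on all four vectors of \<open>v\<close>\<close>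
  obtain g :: "real^3 \<Rightarrow> real" where g: "linear g" "g (v 1) = 1" "g (v 2) = 1" "g (v 3) = 1"
    by (rule superbase_functional[OF v(1)])
  have int: "\<exists>n::int. g x = of_int n" if x: "x \<in> lattice_of v" for x
  proof -
    obtain a b c where "x = of_int a *\<^sub>R v 1 + of_int b *\<^sub>R v 2 + of_int c *\<^sub>R v 3"
      using x unfolding lattice_of_def by blast
    then have "g x = of_int (a + b + c)" using g by (simp add: linear_add linear_scale)
    then show ?thesis by blast
  qed
  have "\<forall>k<4. \<exists>n::int. g (w k) = of_int n"
    using int superbase_mem_lattice[OF superbase_zero[OF w(1)]] L by simp
  then obtain n where n: "\<And>k. k < 4 \<Longrightarrow> g (w k) = of_int (n k)" by metis
  show ?thesis
  proof (cases "\<forall>k<4. odd (n k)")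
    case True
    show ?thesis by (rule RI_odd[OF v w L g]) (use True n in blast)
  next
    case False
    have "g (w 0) = - (g (w 1) + g (w 2) + g (w 3))"
      unfolding superbase_zero[OF w(1)] using g(1) by (simp add: linear_neg linear_add linear_diff)
    then have "of_int (n 0 + n 1 + n 2 + n 3) = (0::real)" by (simp add: n)
    then have sum0: "n 0 + n 1 + n 2 + n 3 = 0" by (simp only: of_int_eq_0_iff)
    \<comment> \<open>If \<open>g\<close> were even on all of \<open>w\<close>, it would be even on
      the whole lattice, contradicting \<open>g (v 1) = 1\<close>.\<close>
    have odd: "\<exists>k<4. odd (n k)"
    proof (rule ccontr)
      assume "\<not> ?thesis"
      then have ev: "even (n 1)" "even (n 2)" "even (n 3)" by simp_all
      have "v 1 \<in> lattice_of w" using superbase_mem_lattice[OF superbase_zero[OF v(1)]] L by simp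
      then obtain a b c where "v 1 = of_int a *\<^sub>R w 1 + of_int b *\<^sub>R w 2 + of_int c *\<^sub>R w 3"
        unfolding lattice_of_def by blast
      then have "g (v 1) = of_int (a * n 1 + b * n 2 + c * n 3)"
        using n[of 1] n[of 2] n[of 3] by (simp add: linear_add[OF g(1)] linear_scale[OF g(1)])
      then have "a * n 1 + b * n 2 + c * n 3 = 1"
        using g(2) by (metis of_int_eq_1_iff)
      moreover have "even (a * n 1 + b * n 2 + c * n 3)" using ev by simp
      ultimately show False by simp
    qed
    obtain \<pi> where \<pi>: "\<pi> permutes {..<4}" and par: "even (n (\<pi> 0))" "even (n (\<pi> 1))" "odd (n (\<pi> 2))" "odd (n (\<pi> 3))"
      using exists_permutation_two_odd[OF sum0 odd] False by blast
    have \<pi>l: "\<pi> k < 4" if "k < 4" for k using permutes_in_image[OF \<pi>, of k] that by simp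
    define w' where "w' = w \<circ> \<pi>"
    note w' = superbase_permute(1)[OF w(1) \<pi>, folded w'_def] obtuse_permute[OF w(2) \<pi>, folded w'_def]
    have L': "lattice_of w' = lattice_of v"
      using superbase_permute(2)[OF w(1) \<pi>] L by (simp add: w'_def)
    have gw': "g (w' k) = of_int (n (\<pi> k))" if "k < 4" for k
      using n \<pi>l that by (simp add: w'_def)
    have "RI w' = RI w"
      by (rule RI_relabel[OF \<pi>]) (simp add: w'_def conorm_def)
    \<comment> \<open>The step adds the odd vector \<open>w' 2\<close> to the two even vectors and
      keeps the parity of the other two, so all four become odd.\<close>
    have gf: "g (flip w' 0) = of_int (n (\<pi> 0) + n (\<pi> 2))" "g (flip w' 1) = of_int (n (\<pi> 1) + n (\<pi> 2))"
        "g (flip w' 2) = of_int (- n (\<pi> 2))" "g (flip w' 3) = of_int (n (\<pi> 3))"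
      unfolding flip_simps linear_add[OF g(1)] linear_neg[OF g(1)] by (simp_all add: gw')
    have odd': "\<exists>m. g (flip w' k) = of_int m \<and> odd m" if "k < 4" for k
      using that gf par unfolding less4_iff
      by (elim disjE) (force simp only: even_add even_minus)+
    have Lf: "lattice_of (flip w') = lattice_of v" using superbase_flip(2)[OF w'(1)] L' by simp
    \<comment> \<open>Orthogonality comes first, from congruence alone; it then yields obtuseness of
      \<open>flip w'\<close>.\<close>
    have 0: "conorm w' 2 3 = 0"
      using odd_superbase_permutation[OF v(1) superbase_flip(1)[OF w'(1)] Lf g odd']
        conorm_zero_of_flip_congruent[OF v w' L'] by blast
    have "RI (flip w') = RI v"
      by (rule RI_odd[OF v superbase_flip(1)[OF w'(1)] obtuse_flip[OF w' 0] Lf g odd'])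
    then show ?thesis using RI_flip[OF w'(1) 0] \<open>RI w' = RI w\<close> by simp
  qed
qed

text \<open>Subtracting \<open>f 0\<close> gives a distance-preserving map fixing the origin, hence
  an orthogonal one. Since 0 is in the first lattice, \<open>f 0\<close> is in the second, which
  translation by it preserves.\<close>

lemma isometric_lattices_linear:
  assumes "isometric_sets (lattice_of v) (lattice_of w)"
  obtains h where "orthogonal_transformation h" "h ` lattice_of v = lattice_of w"
proof -
  obtain f where f: "\<And>x y. dist (f x) (f y) = dist x y" "f ` lattice_of v = lattice_of w"
    using assms unfolding isometric_sets_def by blast
  define h where "h x = f x - f 0" for x
  have "orthogonal_transformation h"
    unfolding orthogonal_transformation_isometry using f(1) by (simp add: h_def dist_norm)
  moreover have "h ` lattice_of v = lattice_of w"
  proof -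
    have f0: "f 0 \<in> lattice_of w" using f(2) lattice_of_0 by blast
    have "h ` lattice_of v = (\<lambda>x. x - f 0) ` lattice_of w"
      unfolding f(2)[symmetric] image_image h_def ..
    also have "\<dots> = lattice_of w"
    proof (intro equalityI subsetI)
      fix x assume "x \<in> lattice_of w"
      then have "x = (x + f 0) - f 0" "x + f 0 \<in> lattice_of w" using f0 by (simp_all add: lattice_of_add)
      then show "x \<in> (\<lambda>x. x - f 0) ` lattice_of w" by blast
    qed (use f0 in \<open>auto intro: lattice_of_diff\<close>)
    finally show ?thesis .
  qed
  ultimately show ?thesis by (rule that)
qed

theorem theorem5p3:
  fixes v w :: "nat \<Rightarrow> real^3"
  assumes "superbase v" and "obtuse v"
    and "superbase w" and "obtuse w"
    and "isometric_sets (lattice_of v) (lattice_of w)"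
  shows "RI v = RI w"
proof -
  obtain h where h: "orthogonal_transformation h" and im: "h ` lattice_of v = lattice_of w"
    using assms(5) by (rule isometric_lattices_linear)
  have lin: "linear h" using h by (simp add: orthogonal_transformation_def)
  \<comment> \<open>The transported superbase \<open>h \<circ> v\<close> has the conorms of
    \<open>v\<close> and generates the lattice of \<open>w\<close>, which reduces the claim to a
    single lattice.\<close>
  have con: "conorm (h \<circ> v) i j = conorm v i j" for i j
    using h by (simp add: conorm_def orthogonal_transformation_def)
  have L: "lattice_of (h \<circ> v) = lattice_of w"
  proof -
    have "h (of_int a *\<^sub>R v 1 + of_int b *\<^sub>R v 2 + of_int c *\<^sub>R v 3) =
        of_int a *\<^sub>R h (v 1) + of_int b *\<^sub>R h (v 2) + of_int c *\<^sub>R h (v 3)" for a b c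
      using lin by (simp add: linear_add linear_scale)
    then have "lattice_of (h \<circ> v) = h ` lattice_of v"
      unfolding lattice_of_def comp_def by (fastforce simp: image_def)
    then show ?thesis using im by simp
  qed
  have "(h \<circ> v) 0 = - ((h \<circ> v) 1 + (h \<circ> v) 2 + (h \<circ> v) 3)"
    unfolding comp_def superbase_zero[OF assms(1)] using lin by (simp add: linear_neg linear_add linear_diff)
  then have "superbase (h \<circ> v)"
    using superbase_of_lattice[OF assms(3) _ L] by blast
  moreover have "obtuse (h \<circ> v)" using assms(2) by (simp add: obtuse_def con)
  ultimately have "RI (h \<circ> v) = RI w"
    by (rule RI_eq_of_lattice_eq[OF assms(3,4) _ _ L])
  moreover have "RI (h \<circ> v) = RI v"
    unfolding RI_eq_root_inv_of by (simp add: rootp_def[abs_def] con)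
  ultimately show ?thesis by simp
qed

end
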